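(* Let $\mathbb{D}=(D,\le_D)$ be a partial order and let $\langle \dot U_{<d},\dot U_d: d\in D\rangle$ be a suitable sequence with associated iteration $\langle\mathbb{P}_{<d},\dot{\mathbb{Q}}_d: d\in D\rangle$ and final poset $\mathbb{M}_{\mathbb{D}}=\mathbb{P}_{\mathbb{D}}$. Let $G\subseteq\mathbb{M}_{\mathbb{D}}$ be $V$-generic and for $d\in D$ let $B_d$ be the interpretation by $G$ of the canonical name $\dot B_d$ for the Mathias generic set added at coordinate $d$. Then for all $d,e\in D$: $B_d\subseteq^* B_e$ if and only if $e\le_D d$. In particular $(\{B_d:d\in D\},\supseteq^* )$ is order-isomorphic to $\mathbb{D}$ via $d\mapsto B_d$.
   Context: For $A,B\subseteq\omega$, $A\subseteq^*B$ means $A\setminus B$ is finite. For $d\in D$, $D_{<d}=\{e\in D: e<_D d\}$. Mathias forcing $\mathbb{M}(F)$ for a filter $F$ on $\omega$ consists of pairs $(a,A)$ with $a\subseteq\omega$ finite and $A\in F$, ordered by $(a,A)\le(b,B)$ iff $b$ is an initial segment of $a$, $A\subseteq B$ and $a\setminus b\subseteq B$. A finite support iteration based on $\mathbb{D}$ is a sequence $\langle\mathbb{P}_{<d},\dot{\mathbb{Q}}_d: d\in D\rangle$ such that for each $d$: $\mathbb{P}_{<d}$ is the set of finitely supported sequences $p=\langle p(e): e\in D_{<d}\rangle$ with $p\restriction D_{<e}\Vdash_{\mathbb{P}_{<e}} p(e)\in\dot{\mathbb{Q}}_e$ for all $e<_Dd$, and $\dot{\mathbb{Q}}_d$ is a $\mathbb{P}_{<d}$-name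 for a partial order; $\mathbb{P}_{\mathbb{D}}$ is defined likewise with $D$ in place of $D_{<d}$; the order is $p\le q$ iff for every $d$, $p\restriction D_{<d}\Vdash p(d)\le_{\dot{\mathbb{Q}}_d} q(d)$; $\mathbb{P}_{\le d}=\mathbb{P}_{<d}*\dot{\mathbb{Q}}_d$. A sequence $\langle\dot U_{<d},\dot U_d: d\in D\rangle$ is suitable if there is such an iteration with: (I) $\dot U_{<d}$ is a $\mathbb{P}_{<d}$-name for an ultrafilter on $\omega$ extending $\bigcup_{e<_Dd}\dot U_e$; (II) $\dot{\mathbb{Q}}_d$ is a $\mathbb{P}_{<d}$-name for $\mathbb{M}(\dot U_{<d})$; (III) $\dot U_d$ is a $\mathbb{P}_{\le d}$-name for an ultrafilter extending $\dot U_{<d}\cup\{\dot B_d\}$, where $\dot B_d=\{(p,\check\alpha): p\restriction D_{<d}\Vdash \check\alpha$ appears in the stem (first coordinate) of $p(d)\}$ is the canonical name for the generic set added by $\dot{\mathbb{Q}}_d$. This iteration is then determined by the sequence and is the associated iteration. *)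

theory Defs
  imports Main
begin

section \<open>Forcing notions, names for reals and for families of reals, the forcing relation\<close>

text \<open>
  The HOL universe plays the role of the ground model \<open>V\<close>.  A \<open>V\<close>-generic filter over an atomless
  forcing notion does not exist in \<open>V\<close>, so truth in \<open>V[G]\<close> for all \<open>V\<close>-generic \<open>G\<close> is expressed, as
  usual, by the forcing relation (``forced by every condition'').

  Sentences of the forcing language are embedded shallowly: a sentence maps a forcing notion and a
  condition to the statement that the condition forces it, and each connective is given by its
  clause in the usual recursive definition of the forcing relation, over \<open>\<not>\<close>, \<open>\<and>\<close>, \<open>\<forall>\<close>.
\<close>

record 'c forcing =
  conds :: "'c set"
  leq :: "'c \<Rightarrow> 'c \<Rightarrow> bool"

definition forcing_notion :: "'c forcing \<Rightarrow> 'c \<Rightarrow> bool" where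
  "forcing_notion P one \<longleftrightarrow>
     reflp_on (conds P) (leq P) \<and> transp_on (conds P) (leq P) \<and>
     one \<in> conds P \<and> (\<forall>p\<in>conds P. leq P p one)"

type_synonym 'c sentence = "'c forcing \<Rightarrow> 'c \<Rightarrow> bool"

definition forces :: "'c \<Rightarrow> 'c forcing \<Rightarrow> 'c sentence \<Rightarrow> bool" ("_ \<tturnstile>\<^bsub>_\<^esub> _" [31, 0, 20] 20) where
  "(p \<tturnstile>\<^bsub>P\<^esub> \<phi>) \<longleftrightarrow> \<phi> P p"

definition forced :: "'c forcing \<Rightarrow> 'c sentence \<Rightarrow> bool" ("\<tturnstile>\<^bsub>_\<^esub> _" [0, 20] 20) where
  "(\<tturnstile>\<^bsub>P\<^esub> \<phi>) \<longleftrightarrow> (\<forall>p\<in>conds P. p \<tturnstile>\<^bsub>P\<^esub> \<phi>)"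

text \<open>The pair \<open>(p, n)\<close> in a name for a real stands for \<open>(p, \<check>n)\<close>.\<close>

type_synonym 'c real_name = "('c \<times> nat) set"
type_synonym 'c family_name = "('c \<times> 'c real_name) set"

definition real_names :: "'c forcing \<Rightarrow> 'c real_name set" where
  "real_names P = Pow (conds P \<times> UNIV)"

definition family_names :: "'c forcing \<Rightarrow> 'c family_name set" where
  "family_names P = Pow (conds P \<times> real_names P)"

text \<open>A statement about the ground model (between check names) is forced iff it is true.\<close>

definition Ground :: "bool \<Rightarrow> 'c sentence" where
  "Ground b = (\<lambda>P p. b)"

definition Neg :: "'c sentence \<Rightarrow> 'c sentence" ("\<^bold>\<not> _" [40] 40) where
  "(\<^bold>\<not> \<phi>) = (\<lambda>P p. \<forall>q\<in>conds P. leq P q p \<longrightarrow> \<not> (q \<tturnstile>\<^bsub>P\<^esub> \<phi>))"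

definition Conj :: "'c sentence \<Rightarrow> 'c sentence \<Rightarrow> 'c sentence" (infixr "\<^bold>\<and>" 35) where
  "(\<phi> \<^bold>\<and> \<psi>) = (\<lambda>P p. (p \<tturnstile>\<^bsub>P\<^esub> \<phi>) \<and> (p \<tturnstile>\<^bsub>P\<^esub> \<psi>))"

definition Imp :: "'c sentence \<Rightarrow> 'c sentence \<Rightarrow> 'c sentence" (infixr "\<^bold>\<longrightarrow>" 25) where
  "(\<phi> \<^bold>\<longrightarrow> \<psi>) = (\<^bold>\<not> (\<phi> \<^bold>\<and> (\<^bold>\<not> \<psi>)))"

definition Disj :: "'c sentence \<Rightarrow> 'c sentence \<Rightarrow> 'c sentence" (infixr "\<^bold>\<or>" 30) where
  "(\<phi> \<^bold>\<or> \<psi>) = (\<^bold>\<not> ((\<^bold>\<not> \<phi>) \<^bold>\<and> (\<^bold>\<not> \<psi>)))"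

definition Iff :: "'c sentence \<Rightarrow> 'c sentence \<Rightarrow> 'c sentence" (infixr "\<^bold>\<longleftrightarrow>" 25) where
  "(\<phi> \<^bold>\<longleftrightarrow> \<psi>) = ((\<phi> \<^bold>\<longrightarrow> \<psi>) \<^bold>\<and> (\<psi> \<^bold>\<longrightarrow> \<phi>))"

text \<open>Quantifiers over a ground model set, given as a type.\<close>

definition AllV :: "('x \<Rightarrow> 'c sentence) \<Rightarrow> 'c sentence" (binder "\<^bold>\<forall>" 10) where
  "(\<^bold>\<forall>x. \<Phi> x) = (\<lambda>P p. \<forall>x. p \<tturnstile>\<^bsub>P\<^esub> \<Phi> x)"

definition ExV :: "('x \<Rightarrow> 'c sentence) \<Rightarrow> 'c sentence" (binder "\<^bold>\<exists>" 10) where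
  "(\<^bold>\<exists>x. \<Phi> x) = (\<^bold>\<not> (\<^bold>\<forall>x. \<^bold>\<not> \<Phi> x))"

text \<open>Quantifier over all subsets of \<open>\<omega>\<close> in the extension.\<close>

definition AllR :: "('c real_name \<Rightarrow> 'c sentence) \<Rightarrow> 'c sentence" (binder "\<^bold>\<forall>\<^sub>R" 10) where
  "(\<^bold>\<forall>\<^sub>R \<sigma>. \<Phi> \<sigma>) = (\<lambda>P p. \<forall>\<sigma>\<in>real_names P. p \<tturnstile>\<^bsub>P\<^esub> \<Phi> \<sigma>)"

definition Mem :: "nat \<Rightarrow> 'c real_name \<Rightarrow> 'c sentence" (infix "\<^bold>\<in>" 50) where
  "(n \<^bold>\<in> \<sigma>) = (\<lambda>P p. \<forall>q\<in>conds P. leq P q p \<longrightarrow>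
     (\<exists>r\<in>conds P. leq P r q \<and> (\<exists>s. (s, n) \<in> \<sigma> \<and> leq P r s)))"

definition Eq :: "'c real_name \<Rightarrow> 'c real_name \<Rightarrow> 'c sentence" (infix "\<^bold>=" 50) where
  "(\<sigma> \<^bold>= \<tau>) = (\<^bold>\<forall>n. n \<^bold>\<in> \<sigma> \<^bold>\<longleftrightarrow> n \<^bold>\<in> \<tau>)"

definition MemF :: "'c real_name \<Rightarrow> 'c family_name \<Rightarrow> 'c sentence" (infix "\<^bold>\<in>\<^sub>F" 50) where
  "(\<tau> \<^bold>\<in>\<^sub>F U) = (\<lambda>P p. \<forall>q\<in>conds P. leq P q p \<longrightarrow>
     (\<exists>r\<in>conds P. leq P r q \<and> (\<exists>s \<sigma>. (s, \<sigma>) \<in> U \<and> leq P r s \<and> (r \<tturnstile>\<^bsub>P\<^esub> \<tau> \<^bold>= \<sigma>))))"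

definition Subset :: "'c real_name \<Rightarrow> 'c real_name \<Rightarrow> 'c sentence" (infix "\<^bold>\<subseteq>" 50) where
  "(\<sigma> \<^bold>\<subseteq> \<tau>) = (\<^bold>\<forall>n. n \<^bold>\<in> \<sigma> \<^bold>\<longrightarrow> n \<^bold>\<in> \<tau>)"

text \<open>
  ``\<open>{n. \<Phi> n}\<close> is finite''; the finite subsets of \<open>\<omega>\<close> in the extension are those of the ground model.
\<close>

definition Finite :: "(nat \<Rightarrow> 'c sentence) \<Rightarrow> 'c sentence" where
  "Finite \<Phi> = (\<^bold>\<exists>F. Ground (finite F) \<^bold>\<and> (\<^bold>\<forall>n. \<Phi> n \<^bold>\<longleftrightarrow> Ground (n \<in> F)))"

definition AlmostSubset :: "'c real_name \<Rightarrow> 'c real_name \<Rightarrow> 'c sentence" (infix "\<^bold>\<subseteq>\<^sup>*" 50) where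
  "(\<sigma> \<^bold>\<subseteq>\<^sup>* \<tau>) = Finite (\<lambda>n. n \<^bold>\<in> \<sigma> \<^bold>\<and> (\<^bold>\<not> n \<^bold>\<in> \<tau>))"

text \<open>Ultrafilters are nonprincipal, as usual in the context of Mathias forcing.\<close>

definition Ultrafilter :: "'c family_name \<Rightarrow> 'c sentence" where
  "Ultrafilter U =
    ((\<^bold>\<forall>\<^sub>R \<sigma>. \<^bold>\<forall>\<^sub>R \<tau>. \<sigma> \<^bold>\<in>\<^sub>F U \<^bold>\<and> \<sigma> \<^bold>\<subseteq> \<tau> \<^bold>\<longrightarrow> \<tau> \<^bold>\<in>\<^sub>F U) \<^bold>\<and>
     (\<^bold>\<forall>\<^sub>R \<sigma>. \<^bold>\<forall>\<^sub>R \<tau>. \<^bold>\<forall>\<^sub>R \<rho>. \<sigma> \<^bold>\<in>\<^sub>F U \<^bold>\<and> \<tau> \<^bold>\<in>\<^sub>F U \<^bold>\<and> (\<^bold>\<forall>n. n \<^bold>\<in> \<rho> \<^bold>\<longleftrightarrow> n \<^bold>\<in> \<sigma> \<^bold>\<and> n \<^bold>\<in> \<tau>) \<^bold>\<longrightarrow> \<rho> \<^bold>\<in>\<^sub>F U) \<^bold>\<and>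
     (\<^bold>\<forall>\<^sub>R \<sigma>. \<^bold>\<forall>\<^sub>R \<tau>. (\<^bold>\<forall>n. n \<^bold>\<in> \<tau> \<^bold>\<longleftrightarrow> (\<^bold>\<not> n \<^bold>\<in> \<sigma>)) \<^bold>\<longrightarrow> \<sigma> \<^bold>\<in>\<^sub>F U \<^bold>\<or> \<tau> \<^bold>\<in>\<^sub>F U) \<^bold>\<and>
     (\<^bold>\<forall>\<^sub>R \<sigma>. \<sigma> \<^bold>\<in>\<^sub>F U \<^bold>\<longrightarrow> (\<^bold>\<not> Finite (\<lambda>n. n \<^bold>\<in> \<sigma>))))"

definition Extends :: "'c family_name \<Rightarrow> 'c family_name \<Rightarrow> 'c sentence" where
  "Extends U W = (\<^bold>\<forall>\<^sub>R \<sigma>. \<sigma> \<^bold>\<in>\<^sub>F W \<^bold>\<longrightarrow> \<sigma> \<^bold>\<in>\<^sub>F U)"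


section \<open>Mathias forcing in the extension\<close>

text \<open>
  A name for a partial order whose elements are pairs of subsets of \<open>\<omega>\<close> (stem, side set), a name
  for such a pair being a pair of names; it is given by the sentences ``\<open>x\<close> is an element'' and
  ``\<open>x\<close> is below \<open>y\<close>''.
\<close>

type_synonym 'c pair_name = "'c real_name \<times> 'c real_name"

record 'c poset_name =
  Elem :: "'c pair_name \<Rightarrow> 'c sentence"
  Leq :: "'c pair_name \<Rightarrow> 'c pair_name \<Rightarrow> 'c sentence"

definition InitialSegment :: "'c real_name \<Rightarrow> 'c real_name \<Rightarrow> 'c sentence" where
  "InitialSegment b a =
     (b \<^bold>\<subseteq> a \<^bold>\<and> (\<^bold>\<forall>n. \<^bold>\<forall>m. n \<^bold>\<in> b \<^bold>\<and> m \<^bold>\<in> a \<^bold>\<and> Ground (m < n) \<^bold>\<longrightarrow> m \<^bold>\<in> b))"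

definition mathias :: "'c family_name \<Rightarrow> 'c poset_name" where
  "mathias F =
    \<lparr> Elem = (\<lambda>(a, A). Finite (\<lambda>n. n \<^bold>\<in> a) \<^bold>\<and> A \<^bold>\<in>\<^sub>F F),
      Leq = (\<lambda>(a, A) (b, B). InitialSegment b a \<^bold>\<and> A \<^bold>\<subseteq> B \<^bold>\<and>
                (\<^bold>\<forall>n. n \<^bold>\<in> a \<^bold>\<and> (\<^bold>\<not> n \<^bold>\<in> b) \<^bold>\<longrightarrow> n \<^bold>\<in> B)) \<rparr>"


section \<open>Finite support iterations along a partial order\<close>

text \<open>
  A condition is a sequence of pairs of names, a name itself being a set of pairs (condition,
  natural number).  As a datatype cannot recurse through unrestricted sets, the names occurring in
  conditions are given as \<open>'k\<close>-indexed families (the name coded by \<open>c\<close> is \<open>ran c\<close>); the index type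
  \<open>'k\<close> is arbitrary, and iterations are required below to have enough codes.

  All conditions have the full index type as domain; \<open>None\<close> stands for the canonical name of the
  largest element \<open>(\<emptyset>, \<omega>)\<close> of Mathias forcing, and is used outside the support.  Thus a sequence
  indexed by a subset of \<open>D\<close> is identified with its extension by trivial coordinates.
\<close>

datatype ('d, 'k) cond =
  Seq (coord: "'d \<Rightarrow> (('k \<Rightarrow> (('d, 'k) cond \<times> nat) option) \<times> ('k \<Rightarrow> (('d, 'k) cond \<times> nat) option)) option")

definition trivial :: "('d, 'k) cond" where
  "trivial = Seq (\<lambda>_. None)"

definition restr :: "('d, 'k) cond \<Rightarrow> 'd set \<Rightarrow> ('d, 'k) cond" where
  "restr p A = Seq (coord p |` A)"

definition entry :: "('d, 'k) cond \<Rightarrow> 'd \<Rightarrow> ('d, 'k) cond pair_name" where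
  "entry p e = (case coord p e of None \<Rightarrow> ({}, {trivial} \<times> UNIV) | Some (a, A) \<Rightarrow> (ran a, ran A))"

text \<open>
  For a downward closed set \<open>A\<close> of indices, \<open>fs_poset r P Q A\<close> consists of the finitely supported
  sequences indexed by \<open>A\<close>, where \<open>P e\<close> stands for \<open>P\<^sub><\<^sub>e\<close>.  For \<open>A = under r d\<close> it is the
  two-step iteration of \<open>P d\<close> and \<open>Q d\<close>, for \<open>A = D\<close> the final poset.
\<close>

definition fs_poset :: "'d rel \<Rightarrow> ('d \<Rightarrow> ('d, 'k) cond forcing) \<Rightarrow>
    ('d \<Rightarrow> ('d, 'k) cond poset_name) \<Rightarrow> 'd set \<Rightarrow> ('d, 'k) cond forcing" where
  "fs_poset r P Q A =
    \<lparr> conds = {p. finite (dom (coord p)) \<and> dom (coord p) \<subseteq> A \<and>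
         (\<forall>e\<in>A. entry p e \<in> real_names (P e) \<times> real_names (P e) \<and>
                (restr p (underS r e) \<tturnstile>\<^bsub>P e\<^esub> Elem (Q e) (entry p e)))},
      leq = (\<lambda>p q. \<forall>e\<in>A. restr p (underS r e) \<tturnstile>\<^bsub>P e\<^esub> Leq (Q e) (entry p e) (entry q e)) \<rparr>"

text \<open>
  The coordinates of conditions range over all names, up to forced equality: every name for a real is forced to be equal
  to a coded one.
\<close>

definition enough_codes :: "('d, 'k) cond forcing \<Rightarrow> bool" where
  "enough_codes P \<longleftrightarrow>
     (\<forall>\<sigma>\<in>real_names P. \<exists>c :: 'k \<Rightarrow> (('d, 'k) cond \<times> nat) option.
        ran c \<in> real_names P \<and> (\<tturnstile>\<^bsub>P\<^esub> \<sigma> \<^bold>= ran c))"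

text \<open>
  For well-founded \<open>r\<close> the family \<open>P\<close> is determined by the first conjunct; in general, \<open>P\<close> is
  only required to satisfy the recursion.
\<close>

definition fs_iteration :: "'d set \<Rightarrow> 'd rel \<Rightarrow> ('d \<Rightarrow> ('d, 'k) cond forcing) \<Rightarrow>
    ('d \<Rightarrow> ('d, 'k) cond poset_name) \<Rightarrow> bool" where
  "fs_iteration D r P Q \<longleftrightarrow>
     (\<forall>d\<in>D. P d = fs_poset r P Q (underS r d) \<and> forcing_notion (P d) trivial \<and> enough_codes (P d))"

definition generic_name :: "'d rel \<Rightarrow> ('d \<Rightarrow> ('d, 'k) cond forcing) \<Rightarrow>
    ('d \<Rightarrow> ('d, 'k) cond poset_name) \<Rightarrow> 'd \<Rightarrow> ('d, 'k) cond real_name" where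
  "generic_name r P Q d =
     {(p, n). p \<in> conds (fs_poset r P Q (under r d)) \<and>
              (restr p (underS r d) \<tturnstile>\<^bsub>P d\<^esub> n \<^bold>\<in> fst (entry p d))}"

text \<open>
  The sequence of the \<open>Ul d\<close> (for \<open>U\<^sub><\<^sub>d\<close>) and \<open>U d\<close> is suitable, with associated iteration \<open>P, Q\<close>.
\<close>

definition suitable :: "'d set \<Rightarrow> 'd rel \<Rightarrow>
    ('d \<Rightarrow> ('d, 'k) cond family_name) \<Rightarrow> ('d \<Rightarrow> ('d, 'k) cond family_name) \<Rightarrow>
    ('d \<Rightarrow> ('d, 'k) cond forcing) \<Rightarrow> ('d \<Rightarrow> ('d, 'k) cond poset_name) \<Rightarrow> bool" where
  "suitable D r Ul U P Q \<longleftrightarrow>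
     fs_iteration D r P Q \<and>
     (\<forall>d\<in>D. Ul d \<in> family_names (P d) \<and> (\<tturnstile>\<^bsub>P d\<^esub> Ultrafilter (Ul d)) \<and>
        (\<forall>e\<in>underS r d. \<tturnstile>\<^bsub>P d\<^esub> Extends (Ul d) (U e))) \<and>
     (\<forall>d\<in>D. Q d = mathias (Ul d)) \<and>
     (\<forall>d\<in>D. let P' = fs_poset r P Q (under r d) in
        U d \<in> family_names P' \<and> (\<tturnstile>\<^bsub>P'\<^esub> Ultrafilter (U d)) \<and>
        (\<tturnstile>\<^bsub>P'\<^esub> Extends (U d) (Ul d)) \<and> (\<tturnstile>\<^bsub>P'\<^esub> generic_name r P Q d \<^bold>\<in>\<^sub>F U d))"

text \<open>
  The map \<open>d \<mapsto> B d\<close> is an order isomorphism of \<open>(D, r)\<close> onto \<open>({B d | d \<in> D}, \<supseteq>\<^sup>*)\<close>; \<open>R\<close> is the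
  canonical name for its range.
\<close>

definition OrderIso :: "'d set \<Rightarrow> 'd rel \<Rightarrow> ('d \<Rightarrow> ('d, 'k) cond real_name) \<Rightarrow> ('d, 'k) cond sentence" where
  "OrderIso D r B =
    (let R = {(trivial, B d) | d. d \<in> D} in
      (\<^bold>\<forall>d. Ground (d \<in> D) \<^bold>\<longrightarrow> B d \<^bold>\<in>\<^sub>F R) \<^bold>\<and>
      (\<^bold>\<forall>\<^sub>R \<sigma>. \<sigma> \<^bold>\<in>\<^sub>F R \<^bold>\<longrightarrow> (\<^bold>\<exists>d. Ground (d \<in> D) \<^bold>\<and> \<sigma> \<^bold>= B d)) \<^bold>\<and>
      (\<^bold>\<forall>d. \<^bold>\<forall>e. Ground (d \<in> D \<and> e \<in> D) \<^bold>\<longrightarrow>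
         (B d \<^bold>= B e \<^bold>\<longrightarrow> Ground (d = e)) \<^bold>\<and>
         (Ground ((e, d) \<in> r) \<^bold>\<longleftrightarrow> B d \<^bold>\<subseteq>\<^sup>* B e)))"

end

theory Submission
  imports Defs
begin

text \<open>
  If \<open>e <\<^sub>D d\<close>, then \<open>B\<^sub>e\<close> belongs to \<open>U\<^sub><\<^sub>d\<close>, so once the stem at \<open>d\<close> is decided, the side set at \<open>d\<close>
  may be intersected with \<open>B\<^sub>e\<close>; from then on everything outside the stem that enters \<open>B\<^sub>d\<close> lies in
  \<open>B\<^sub>e\<close>.  If \<open>e\<close> is not below \<open>d\<close>, no condition decides \<open>B\<^sub>d \<setminus> B\<^sub>e\<close> to be a given finite set: decide
  the stem at \<open>e\<close>, use that \<open>B\<^sub>d\<close> is infinite, being a member of a nonprincipal ultrafilter, to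
  force a new large \<open>n\<close> into \<open>B\<^sub>d\<close> by extending only coordinates \<open>\<le>\<^sub>D d\<close>, and then remove \<open>n\<close> from
  the side set at \<open>e\<close>.
\<close>

section \<open>The forcing relation over a preorder\<close>

text \<open>Two obstacles shape the development. A stem is only a name for a finite set, so nothing
  can be compared with it until a condition decides it. Moreover, the entry at \<open>e\<close> is
  evaluated by its own forcing \<open>P e\<close>, while the generic sets are compared over the
  final poset, so statements have to travel between the posets of sequences indexed by downward
  closed sets. Restriction is a projection between these posets: membership in a name of the smaller
  one may be tested on either side, and a strengthening found on a small index set can be pasted
  into a large condition. This is what carries the negative half: if
  \<open>(e, d) \<notin> r\<close>, then \<open>under r d\<close> omits \<open>e\<close>, so
  whatever the part of a condition on \<open>under r d\<close> forces about the set at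
  \<open>d\<close> survives a later change at \<open>e\<close>. The stem at \<open>e\<close> must be
  decided before the new point is chosen, because a point already in the stem could no longer be
  kept out of the set at \<open>e\<close>.\<close>

definition below :: "'c forcing \<Rightarrow> 'c \<Rightarrow> 'c set" where
  "below P p = {q \<in> conds P. leq P q p}"

lemma belowD: "q \<in> below P p \<Longrightarrow> q \<in> conds P" "q \<in> below P p \<Longrightarrow> leq P q p"
  by (auto simp: below_def)

text \<open>The conditions forcing \<phi> form a regular open set. The single equivalence packs
  persistence to stronger conditions together with the principle that forcing densely below
  \<open>p\<close> is forcing at \<open>p\<close>.\<close>

definition regular :: "'c forcing \<Rightarrow> 'c sentence \<Rightarrow> bool" where
  "regular P \<phi> \<longleftrightarrow>
     (\<forall>p\<in>conds P. (p \<tturnstile>\<^bsub>P\<^esub> \<phi>) \<longleftrightarrow> (\<forall>q\<in>below P p. \<exists>s\<in>below P q. s \<tturnstile>\<^bsub>P\<^esub> \<phi>))"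

lemma forces_Ground [simp]: "(p \<tturnstile>\<^bsub>P\<^esub> Ground b) \<longleftrightarrow> b"
  by (simp add: forces_def Ground_def)

lemma forces_Conj [simp]: "(p \<tturnstile>\<^bsub>P\<^esub> \<phi> \<^bold>\<and> \<psi>) \<longleftrightarrow> (p \<tturnstile>\<^bsub>P\<^esub> \<phi>) \<and> (p \<tturnstile>\<^bsub>P\<^esub> \<psi>)"
  by (simp add: forces_def Conj_def)

lemma forces_AllV [simp]: "(p \<tturnstile>\<^bsub>P\<^esub> AllV \<Phi>) \<longleftrightarrow> (\<forall>x. p \<tturnstile>\<^bsub>P\<^esub> \<Phi> x)"
  by (simp add: forces_def AllV_def)

lemma forces_AllR [simp]: "(p \<tturnstile>\<^bsub>P\<^esub> AllR \<Phi>) \<longleftrightarrow> (\<forall>\<sigma>\<in>real_names P. p \<tturnstile>\<^bsub>P\<^esub> \<Phi> \<sigma>)"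
  by (simp add: forces_def AllR_def)

lemma forces_Neg: "(p \<tturnstile>\<^bsub>P\<^esub> \<^bold>\<not> \<phi>) \<longleftrightarrow> (\<forall>q\<in>below P p. \<not> (q \<tturnstile>\<^bsub>P\<^esub> \<phi>))"
  by (auto simp: forces_def Neg_def below_def)

lemma forces_Mem:
  "(p \<tturnstile>\<^bsub>P\<^esub> n \<^bold>\<in> \<sigma>) \<longleftrightarrow> (\<forall>q\<in>below P p. \<exists>t\<in>below P q. \<exists>s. (s, n) \<in> \<sigma> \<and> leq P t s)"
  by (auto simp: forces_def Mem_def below_def Ball_def Bex_def)

lemma forces_MemF:
  "(p \<tturnstile>\<^bsub>P\<^esub> \<tau> \<^bold>\<in>\<^sub>F W) \<longleftrightarrow>
     (\<forall>q\<in>below P p. \<exists>t\<in>below P q. \<exists>s \<sigma>. (s, \<sigma>) \<in> W \<and> leq P t s \<and> (t \<tturnstile>\<^bsub>P\<^esub> \<tau> \<^bold>= \<sigma>))"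
  by (auto simp: forces_def MemF_def below_def Ball_def Bex_def)

locale forcing_preorder =
  fixes P :: "'c forcing"
  assumes leq_refl: "p \<in> conds P \<Longrightarrow> leq P p p"
    and leq_trans: "\<lbrakk>p \<in> conds P; q \<in> conds P; s \<in> conds P; leq P p q; leq P q s\<rbrakk> \<Longrightarrow> leq P p s"
begin

lemma below_refl: "p \<in> conds P \<Longrightarrow> p \<in> below P p"
  by (simp add: below_def leq_refl)

lemma below_trans: "\<lbrakk>q \<in> below P p; s \<in> below P q; p \<in> conds P\<rbrakk> \<Longrightarrow> s \<in> below P p"
  unfolding below_def using leq_trans by blast

lemma regularI:
  assumes "\<And>p q. \<lbrakk>p \<in> conds P; q \<in> below P p; p \<tturnstile>\<^bsub>P\<^esub> \<phi>\<rbrakk> \<Longrightarrow> q \<tturnstile>\<^bsub>P\<^esub> \<phi>"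
    and "\<And>p. \<lbrakk>p \<in> conds P; \<And>q. q \<in> below P p \<Longrightarrow> \<exists>s\<in>below P q. s \<tturnstile>\<^bsub>P\<^esub> \<phi>\<rbrakk> \<Longrightarrow> p \<tturnstile>\<^bsub>P\<^esub> \<phi>"
  shows "regular P \<phi>"
  unfolding regular_def by (metis assms below_refl belowD(1))

lemma forces_mono: "\<lbrakk>regular P \<phi>; p \<in> conds P; p \<tturnstile>\<^bsub>P\<^esub> \<phi>; q \<in> below P p\<rbrakk> \<Longrightarrow> q \<tturnstile>\<^bsub>P\<^esub> \<phi>"
  unfolding regular_def by (metis below_trans belowD(1))

lemma forces_dense:
  "\<lbrakk>regular P \<phi>; p \<in> conds P; \<And>q. q \<in> below P p \<Longrightarrow> \<exists>s\<in>below P q. s \<tturnstile>\<^bsub>P\<^esub> \<phi>\<rbrakk> \<Longrightarrow> p \<tturnstile>\<^bsub>P\<^esub> \<phi>"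
  unfolding regular_def by blast

lemma regular_Ground [simp]: "regular P (Ground b)"
  by (rule regularI) (auto dest: below_refl)

lemma regular_Conj [simp]:
  assumes "regular P \<phi>" "regular P \<psi>"
  shows "regular P (\<phi> \<^bold>\<and> \<psi>)"
proof (rule regularI)
  fix p q assume "p \<in> conds P" "q \<in> below P p" "p \<tturnstile>\<^bsub>P\<^esub> \<phi> \<^bold>\<and> \<psi>"
  then show "q \<tturnstile>\<^bsub>P\<^esub> \<phi> \<^bold>\<and> \<psi>" using assms forces_mono by simp
next
  fix p assume p: "p \<in> conds P" "\<And>q. q \<in> below P p \<Longrightarrow> \<exists>s\<in>below P q. s \<tturnstile>\<^bsub>P\<^esub> \<phi> \<^bold>\<and> \<psi>"
  then show "p \<tturnstile>\<^bsub>P\<^esub> \<phi> \<^bold>\<and> \<psi>" unfolding forces_Conj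
    by (intro conjI forces_dense[OF assms(1)] forces_dense[OF assms(2)]) blast+
qed

lemma regular_AllV [simp]:
  assumes "\<And>x. regular P (\<Phi> x)"
  shows "regular P (AllV \<Phi>)"
proof (rule regularI)
  fix p q assume "p \<in> conds P" "q \<in> below P p" "p \<tturnstile>\<^bsub>P\<^esub> AllV \<Phi>"
  then show "q \<tturnstile>\<^bsub>P\<^esub> AllV \<Phi>" using assms forces_mono by simp
next
  fix p assume p: "p \<in> conds P" "\<And>q. q \<in> below P p \<Longrightarrow> \<exists>s\<in>below P q. s \<tturnstile>\<^bsub>P\<^esub> AllV \<Phi>"
  then show "p \<tturnstile>\<^bsub>P\<^esub> AllV \<Phi>" unfolding forces_AllV
    by (intro allI forces_dense[OF assms]) blast+
qed

lemma regular_Neg [simp]: "regular P \<phi> \<Longrightarrow> regular P (\<^bold>\<not> \<phi>)"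
  by (rule regularI; unfold forces_Neg)
    (meson below_trans, meson forces_mono below_refl belowD(1))

lemma regular_Imp [simp]: "\<lbrakk>regular P \<phi>; regular P \<psi>\<rbrakk> \<Longrightarrow> regular P (\<phi> \<^bold>\<longrightarrow> \<psi>)"
  by (simp add: Imp_def)

lemma regular_Iff [simp]: "\<lbrakk>regular P \<phi>; regular P \<psi>\<rbrakk> \<Longrightarrow> regular P (\<phi> \<^bold>\<longleftrightarrow> \<psi>)"
  by (simp add: Iff_def)

lemma regular_ExV [simp]: "(\<And>x. regular P (\<Phi> x)) \<Longrightarrow> regular P (ExV \<Phi>)"
  by (simp add: ExV_def)

lemma regular_Mem [simp]: "regular P (n \<^bold>\<in> \<sigma>)"
  by (rule regularI; unfold forces_Mem) (meson below_trans below_refl belowD(1))+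

lemma regular_Eq [simp]: "regular P (\<sigma> \<^bold>= \<tau>)"
  by (simp add: Eq_def)

lemma regular_MemF [simp]: "regular P (\<sigma> \<^bold>\<in>\<^sub>F W)"
  by (rule regularI; unfold forces_MemF) (meson below_trans below_refl belowD(1))+

lemma regular_Subset [simp]: "regular P (\<sigma> \<^bold>\<subseteq> \<tau>)"
  by (simp add: Subset_def)

lemma regular_Finite [simp]: "(\<And>n. regular P (\<Phi> n)) \<Longrightarrow> regular P (Finite \<Phi>)"
  by (simp add: Finite_def)

lemma regular_AlmostSubset [simp]: "regular P (\<sigma> \<^bold>\<subseteq>\<^sup>* \<tau>)"
  by (simp add: AlmostSubset_def)

lemma regular_Leq_mathias [simp]: "regular P (Leq (mathias W) x y)"
  by (cases x; cases y) (simp add: mathias_def InitialSegment_def)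

lemma regular_Elem_mathias [simp]: "regular P (Elem (mathias W) x)"
  by (cases x) (simp add: mathias_def)

section \<open>Semantic clauses for the defined connectives and for the Mathias order\<close>

lemma forces_Imp:
  assumes "p \<in> conds P" "regular P \<phi>" "regular P \<psi>"
  shows "(p \<tturnstile>\<^bsub>P\<^esub> \<phi> \<^bold>\<longrightarrow> \<psi>) \<longleftrightarrow> (\<forall>q\<in>below P p. (q \<tturnstile>\<^bsub>P\<^esub> \<phi>) \<longrightarrow> (q \<tturnstile>\<^bsub>P\<^esub> \<psi>))"
proof
  assume L: "p \<tturnstile>\<^bsub>P\<^esub> \<phi> \<^bold>\<longrightarrow> \<psi>"
  show "\<forall>q\<in>below P p. (q \<tturnstile>\<^bsub>P\<^esub> \<phi>) \<longrightarrow> (q \<tturnstile>\<^bsub>P\<^esub> \<psi>)"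
  proof (intro ballI impI)
    fix q assume q: "q \<in> below P p" and f: "q \<tturnstile>\<^bsub>P\<^esub> \<phi>"
    show "q \<tturnstile>\<^bsub>P\<^esub> \<psi>"
    proof (rule forces_dense[OF assms(3) belowD(1)[OF q]])
      fix s assume s: "s \<in> below P q"
      have "s \<tturnstile>\<^bsub>P\<^esub> \<phi>" using forces_mono[OF assms(2) belowD(1)[OF q] f s] .
      moreover have "s \<in> below P p" using below_trans[OF q s assms(1)] .
      ultimately have "\<not> (s \<tturnstile>\<^bsub>P\<^esub> \<^bold>\<not> \<psi>)"
        using L unfolding Imp_def by (simp add: forces_Neg[of p])
      then show "\<exists>t\<in>below P s. t \<tturnstile>\<^bsub>P\<^esub> \<psi>" by (simp add: forces_Neg)
    qed
  qed
next
  assume R: "\<forall>q\<in>below P p. (q \<tturnstile>\<^bsub>P\<^esub> \<phi>) \<longrightarrow> (q \<tturnstile>\<^bsub>P\<^esub> \<psi>)"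
  then show "p \<tturnstile>\<^bsub>P\<^esub> \<phi> \<^bold>\<longrightarrow> \<psi>"
    unfolding Imp_def by (auto simp: forces_Neg) (meson below_refl belowD(1))
qed

lemma forces_Iff:
  assumes "p \<in> conds P" "regular P \<phi>" "regular P \<psi>"
  shows "(p \<tturnstile>\<^bsub>P\<^esub> \<phi> \<^bold>\<longleftrightarrow> \<psi>) \<longleftrightarrow> (\<forall>q\<in>below P p. (q \<tturnstile>\<^bsub>P\<^esub> \<phi>) \<longleftrightarrow> (q \<tturnstile>\<^bsub>P\<^esub> \<psi>))"
  unfolding Iff_def forces_Conj by (auto simp: forces_Imp assms)

lemma forces_ExV: "(p \<tturnstile>\<^bsub>P\<^esub> ExV \<Phi>) \<longleftrightarrow> (\<forall>q\<in>below P p. \<exists>s\<in>below P q. \<exists>x. s \<tturnstile>\<^bsub>P\<^esub> \<Phi> x)"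
  by (simp add: ExV_def forces_Neg) blast

lemma forces_Disj: "(p \<tturnstile>\<^bsub>P\<^esub> \<phi> \<^bold>\<or> \<psi>) \<longleftrightarrow> (\<forall>q\<in>below P p. \<exists>s\<in>below P q. (s \<tturnstile>\<^bsub>P\<^esub> \<phi>) \<or> (s \<tturnstile>\<^bsub>P\<^esub> \<psi>))"
  by (auto simp: Disj_def forces_Neg)

lemma forces_Eq:
  "p \<in> conds P \<Longrightarrow> (p \<tturnstile>\<^bsub>P\<^esub> \<sigma> \<^bold>= \<tau>) \<longleftrightarrow> (\<forall>q\<in>below P p. \<forall>n. (q \<tturnstile>\<^bsub>P\<^esub> n \<^bold>\<in> \<sigma>) \<longleftrightarrow> (q \<tturnstile>\<^bsub>P\<^esub> n \<^bold>\<in> \<tau>))"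
  unfolding Eq_def by (auto simp: forces_Iff)

lemma forces_Subset:
  "p \<in> conds P \<Longrightarrow> (p \<tturnstile>\<^bsub>P\<^esub> \<sigma> \<^bold>\<subseteq> \<tau>) \<longleftrightarrow> (\<forall>q\<in>below P p. \<forall>n. (q \<tturnstile>\<^bsub>P\<^esub> n \<^bold>\<in> \<sigma>) \<longrightarrow> (q \<tturnstile>\<^bsub>P\<^esub> n \<^bold>\<in> \<tau>))"
  unfolding Subset_def by (auto simp: forces_Imp)

lemma forces_Leq_mathias:
  assumes "p \<in> conds P"
  shows "(p \<tturnstile>\<^bsub>P\<^esub> Leq (mathias W) x y) \<longleftrightarrow>
    (\<forall>q\<in>below P p. \<forall>n. (q \<tturnstile>\<^bsub>P\<^esub> n \<^bold>\<in> fst y) \<longrightarrow> (q \<tturnstile>\<^bsub>P\<^esub> n \<^bold>\<in> fst x)) \<and>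
    (\<forall>n m. \<forall>q\<in>below P p. (q \<tturnstile>\<^bsub>P\<^esub> n \<^bold>\<in> fst y) \<and> (q \<tturnstile>\<^bsub>P\<^esub> m \<^bold>\<in> fst x) \<and> m < n \<longrightarrow> (q \<tturnstile>\<^bsub>P\<^esub> m \<^bold>\<in> fst y)) \<and>
    (\<forall>q\<in>below P p. \<forall>n. (q \<tturnstile>\<^bsub>P\<^esub> n \<^bold>\<in> snd x) \<longrightarrow> (q \<tturnstile>\<^bsub>P\<^esub> n \<^bold>\<in> snd y)) \<and>
    (\<forall>n. \<forall>q\<in>below P p. (q \<tturnstile>\<^bsub>P\<^esub> n \<^bold>\<in> fst x) \<and> (q \<tturnstile>\<^bsub>P\<^esub> \<^bold>\<not> n \<^bold>\<in> fst y) \<longrightarrow> (q \<tturnstile>\<^bsub>P\<^esub> n \<^bold>\<in> snd y))"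
  by (cases x; cases y)
    (simp add: mathias_def InitialSegment_def forces_Subset[OF assms] forces_Imp[OF assms])

lemma Leq_mathiasI:
  assumes "p \<in> conds P"
    and "\<And>q n. \<lbrakk>q \<in> below P p; q \<tturnstile>\<^bsub>P\<^esub> n \<^bold>\<in> fst y\<rbrakk> \<Longrightarrow> q \<tturnstile>\<^bsub>P\<^esub> n \<^bold>\<in> fst x"
    and "\<And>q n m. \<lbrakk>q \<in> below P p; q \<tturnstile>\<^bsub>P\<^esub> n \<^bold>\<in> fst y; q \<tturnstile>\<^bsub>P\<^esub> m \<^bold>\<in> fst x; m < n\<rbrakk> \<Longrightarrow> q \<tturnstile>\<^bsub>P\<^esub> m \<^bold>\<in> fst y"
    and "\<And>q n. \<lbrakk>q \<in> below P p; q \<tturnstile>\<^bsub>P\<^esub> n \<^bold>\<in> snd x\<rbrakk> \<Longrightarrow> q \<tturnstile>\<^bsub>P\<^esub> n \<^bold>\<in> snd y"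
    and "\<And>q n. \<lbrakk>q \<in> below P p; q \<tturnstile>\<^bsub>P\<^esub> n \<^bold>\<in> fst x; q \<tturnstile>\<^bsub>P\<^esub> \<^bold>\<not> n \<^bold>\<in> fst y\<rbrakk> \<Longrightarrow> q \<tturnstile>\<^bsub>P\<^esub> n \<^bold>\<in> snd y"
  shows "p \<tturnstile>\<^bsub>P\<^esub> Leq (mathias W) x y"
  unfolding forces_Leq_mathias[OF assms(1)]
  by (intro conjI ballI allI impI; (elim conjE)?; rule assms; assumption)

lemma Leq_mathiasD:
  assumes "p \<in> conds P" "p \<tturnstile>\<^bsub>P\<^esub> Leq (mathias W) x y" "q \<in> below P p"
  shows "q \<tturnstile>\<^bsub>P\<^esub> n \<^bold>\<in> fst y \<Longrightarrow> q \<tturnstile>\<^bsub>P\<^esub> n \<^bold>\<in> fst x"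
    and "\<lbrakk>q \<tturnstile>\<^bsub>P\<^esub> n \<^bold>\<in> fst y; q \<tturnstile>\<^bsub>P\<^esub> m \<^bold>\<in> fst x; m < n\<rbrakk> \<Longrightarrow> q \<tturnstile>\<^bsub>P\<^esub> m \<^bold>\<in> fst y"
    and "q \<tturnstile>\<^bsub>P\<^esub> n \<^bold>\<in> snd x \<Longrightarrow> q \<tturnstile>\<^bsub>P\<^esub> n \<^bold>\<in> snd y"
    and "\<lbrakk>q \<tturnstile>\<^bsub>P\<^esub> n \<^bold>\<in> fst x; q \<tturnstile>\<^bsub>P\<^esub> \<^bold>\<not> n \<^bold>\<in> fst y\<rbrakk> \<Longrightarrow> q \<tturnstile>\<^bsub>P\<^esub> n \<^bold>\<in> snd y"
  using assms(2)[unfolded forces_Leq_mathias[OF assms(1)]] assms(3) by metis+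

lemma Leq_mathias_refl:
  assumes p: "p \<in> conds P"
  shows "p \<tturnstile>\<^bsub>P\<^esub> Leq (mathias W) x x"
proof (rule Leq_mathiasI[OF p])
  fix q n assume q: "q \<in> below P p" and "q \<tturnstile>\<^bsub>P\<^esub> n \<^bold>\<in> fst x" "q \<tturnstile>\<^bsub>P\<^esub> \<^bold>\<not> n \<^bold>\<in> fst x"
  then show "q \<tturnstile>\<^bsub>P\<^esub> n \<^bold>\<in> snd x" using below_refl[OF belowD(1)[OF q]] by (simp add: forces_Neg)
qed

lemma Mem_cases:
  assumes "p \<in> conds P"
  obtains q where "q \<in> below P p" "(q \<tturnstile>\<^bsub>P\<^esub> n \<^bold>\<in> \<sigma>) \<or> (q \<tturnstile>\<^bsub>P\<^esub> \<^bold>\<not> n \<^bold>\<in> \<sigma>)"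
  by (cases "p \<tturnstile>\<^bsub>P\<^esub> \<^bold>\<not> n \<^bold>\<in> \<sigma>") (use below_refl[OF assms] in \<open>auto simp: forces_Neg\<close>)

text \<open>The Mathias order puts a point of the stem of \<open>x\<close> into the side set of
  \<open>y\<close> only when it is forced to be new. A condition may leave open whether it is new,
  so an extension deciding this is taken.\<close>

lemma Leq_mathias_step:
  assumes p: "p \<in> conds P" and "p \<tturnstile>\<^bsub>P\<^esub> Leq (mathias W) x y" "p \<tturnstile>\<^bsub>P\<^esub> n \<^bold>\<in> fst x"
  obtains q where "q \<in> below P p" "(q \<tturnstile>\<^bsub>P\<^esub> n \<^bold>\<in> fst y) \<or> (q \<tturnstile>\<^bsub>P\<^esub> n \<^bold>\<in> snd y)"
proof -
  obtain q where q: "q \<in> below P p" "(q \<tturnstile>\<^bsub>P\<^esub> n \<^bold>\<in> fst y) \<or> (q \<tturnstile>\<^bsub>P\<^esub> \<^bold>\<not> n \<^bold>\<in> fst y)"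
    using Mem_cases[OF p] by blast
  moreover have "q \<tturnstile>\<^bsub>P\<^esub> n \<^bold>\<in> fst x" using forces_mono[OF regular_Mem p assms(3) q(1)] .
  ultimately show ?thesis using that Leq_mathiasD(4)[OF p assms(2) q(1)] by blast
qed

lemma Leq_mathias_trans:
  assumes p: "p \<in> conds P" and xy: "p \<tturnstile>\<^bsub>P\<^esub> Leq (mathias W) x y" and yz: "p \<tturnstile>\<^bsub>P\<^esub> Leq (mathias W) y z"
  shows "p \<tturnstile>\<^bsub>P\<^esub> Leq (mathias W) x z"
proof (rule Leq_mathiasI[OF p])
  note D = Leq_mathiasD[OF p xy] Leq_mathiasD[OF p yz]
  fix q n assume q: "q \<in> below P p"
  {
    assume "q \<tturnstile>\<^bsub>P\<^esub> n \<^bold>\<in> fst z"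
    then show "q \<tturnstile>\<^bsub>P\<^esub> n \<^bold>\<in> fst x" by (intro D(1)[OF q] D(5)[OF q])
  next
    fix m assume n: "q \<tturnstile>\<^bsub>P\<^esub> n \<^bold>\<in> fst z" and m: "q \<tturnstile>\<^bsub>P\<^esub> m \<^bold>\<in> fst x" "m < n"
    show "q \<tturnstile>\<^bsub>P\<^esub> m \<^bold>\<in> fst z" using D(6)[OF q n D(2)[OF q D(5)[OF q n] m] m(2)] .
  next
    assume "q \<tturnstile>\<^bsub>P\<^esub> n \<^bold>\<in> snd x"
    then show "q \<tturnstile>\<^bsub>P\<^esub> n \<^bold>\<in> snd z" by (intro D(7)[OF q] D(3)[OF q])
  next
    assume a: "q \<tturnstile>\<^bsub>P\<^esub> n \<^bold>\<in> fst x" "q \<tturnstile>\<^bsub>P\<^esub> \<^bold>\<not> n \<^bold>\<in> fst z"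
    have qc: "q \<in> conds P" using q by (rule belowD)
    \<comment> \<open>Whether \<open>n\<close> already lies in the middle stem is not decided by
      \<open>q\<close>; the side set of \<open>z\<close> is therefore reached only densely.\<close>
    show "q \<tturnstile>\<^bsub>P\<^esub> n \<^bold>\<in> snd z"
    proof (rule forces_dense[OF regular_Mem qc])
      fix s assume s: "s \<in> below P q"
      have sp: "s \<in> below P p" and sc: "s \<in> conds P" using below_trans[OF q s p] belowD(1)[OF s] .
      have "s \<tturnstile>\<^bsub>P\<^esub> Leq (mathias W) x y" using forces_mono[OF regular_Leq_mathias p xy sp] .
      moreover have "s \<tturnstile>\<^bsub>P\<^esub> n \<^bold>\<in> fst x" using forces_mono[OF regular_Mem qc a(1) s] .
      ultimately obtain t where t: "t \<in> below P s" "(t \<tturnstile>\<^bsub>P\<^esub> n \<^bold>\<in> fst y) \<or> (t \<tturnstile>\<^bsub>P\<^esub> n \<^bold>\<in> snd y)"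
        using Leq_mathias_step[OF sc] by metis
      have tp: "t \<in> below P p" using below_trans[OF sp t(1) p] .
      have "t \<tturnstile>\<^bsub>P\<^esub> \<^bold>\<not> n \<^bold>\<in> fst z" using forces_mono[OF _ qc a(2) below_trans[OF s t(1) qc]] by simp
      then have "t \<tturnstile>\<^bsub>P\<^esub> n \<^bold>\<in> snd z" using t(2) D(7,8)[OF tp] by blast
      with t(1) show "\<exists>t\<in>below P s. t \<tturnstile>\<^bsub>P\<^esub> n \<^bold>\<in> snd z" ..
    qed
  }
qed

section \<open>Finite sets in the extension\<close>

lemma forces_Finite:
  assumes "\<And>n. regular P (\<Phi> n)" "p \<in> conds P"
  shows "(p \<tturnstile>\<^bsub>P\<^esub> Finite \<Phi>) \<longleftrightarrow>
    (\<forall>q\<in>below P p. \<exists>s\<in>below P q. \<exists>F. finite F \<and> (\<forall>t\<in>below P s. \<forall>n. (t \<tturnstile>\<^bsub>P\<^esub> \<Phi> n) \<longleftrightarrow> n \<in> F))"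
proof -
  have "(s \<tturnstile>\<^bsub>P\<^esub> Ground (finite F) \<^bold>\<and> (\<^bold>\<forall>n. \<Phi> n \<^bold>\<longleftrightarrow> Ground (n \<in> F))) \<longleftrightarrow>
     finite F \<and> (\<forall>t\<in>below P s. \<forall>n. (t \<tturnstile>\<^bsub>P\<^esub> \<Phi> n) \<longleftrightarrow> n \<in> F)" if "s \<in> conds P" for s F
    by (auto simp: forces_Iff assms that)
  then show ?thesis unfolding Finite_def forces_ExV by (meson belowD(1))
qed

lemma Finite_decide:
  assumes "\<And>n. regular P (\<Phi> n)" "p \<in> conds P" "p \<tturnstile>\<^bsub>P\<^esub> Finite \<Phi>"
  obtains q F where "q \<in> below P p" "finite F" "\<And>s n. s \<in> below P q \<Longrightarrow> (s \<tturnstile>\<^bsub>P\<^esub> \<Phi> n) \<longleftrightarrow> n \<in> F"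
proof -
  obtain q F where "q \<in> below P p" "finite F" "\<forall>s\<in>below P q. \<forall>n. (s \<tturnstile>\<^bsub>P\<^esub> \<Phi> n) \<longleftrightarrow> n \<in> F"
    using assms(3)[unfolded forces_Finite[OF assms(1,2)]] below_refl[OF assms(2)] by meson
  then show ?thesis by (intro that) auto
qed

lemma decide_finitely_many:
  assumes "finite F" "\<And>n. regular P (\<Phi> n)" "p \<in> conds P"
  obtains q where "q \<in> below P p" "\<And>n. n \<in> F \<Longrightarrow> (q \<tturnstile>\<^bsub>P\<^esub> \<Phi> n) \<or> (q \<tturnstile>\<^bsub>P\<^esub> \<^bold>\<not> \<Phi> n)"
proof -
  have "\<exists>q\<in>below P p. \<forall>n\<in>F. (q \<tturnstile>\<^bsub>P\<^esub> \<Phi> n) \<or> (q \<tturnstile>\<^bsub>P\<^esub> \<^bold>\<not> \<Phi> n)"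
    using assms(1)
  proof induction
    case empty
    then show ?case using below_refl[OF assms(3)] by blast
  next
    case (insert m F)
    then obtain q where q: "q \<in> below P p" "\<forall>n\<in>F. (q \<tturnstile>\<^bsub>P\<^esub> \<Phi> n) \<or> (q \<tturnstile>\<^bsub>P\<^esub> \<^bold>\<not> \<Phi> n)" by blast
    obtain s where s: "s \<in> below P q" "(s \<tturnstile>\<^bsub>P\<^esub> \<Phi> m) \<or> (s \<tturnstile>\<^bsub>P\<^esub> \<^bold>\<not> \<Phi> m)"
      by (cases "q \<tturnstile>\<^bsub>P\<^esub> \<^bold>\<not> \<Phi> m")
        (use below_refl[OF belowD(1)[OF q(1)]] in \<open>auto simp: forces_Neg\<close>)
    have "(s \<tturnstile>\<^bsub>P\<^esub> \<Phi> n) \<or> (s \<tturnstile>\<^bsub>P\<^esub> \<^bold>\<not> \<Phi> n)" if "n \<in> F" for n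
      using q s(1) that forces_mono[OF _ belowD(1)[OF q(1)] _ s(1)] assms(2) by (meson regular_Neg)
    with s below_trans[OF q(1) s(1) assms(3)] show ?case by blast
  qed
  then show ?thesis using that by blast
qed

text \<open>\<open>Finite\<close> asks for an exact finite set of the ground model, whereas the
  arguments below provide only an upper bound. Deciding each of the finitely many points of
  \<open>F\<close> turns the bound into such a set, on a dense set of conditions.\<close>

lemma Finite_bounded:
  assumes F: "finite F" and reg: "\<And>n. regular P (\<Phi> n)" and p: "p \<in> conds P"
    and bd: "\<And>q n. \<lbrakk>q \<in> below P p; q \<tturnstile>\<^bsub>P\<^esub> \<Phi> n\<rbrakk> \<Longrightarrow> n \<in> F"
  shows "p \<tturnstile>\<^bsub>P\<^esub> Finite \<Phi>"
  unfolding forces_Finite[OF reg p]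
proof
  fix q assume q: "q \<in> below P p"
  obtain s where s: "s \<in> below P q" "\<And>n. n \<in> F \<Longrightarrow> (s \<tturnstile>\<^bsub>P\<^esub> \<Phi> n) \<or> (s \<tturnstile>\<^bsub>P\<^esub> \<^bold>\<not> \<Phi> n)"
    by (rule decide_finitely_many[where \<Phi> = \<Phi>, OF F reg belowD(1)[OF q]]) (rule that)
  have "(t \<tturnstile>\<^bsub>P\<^esub> \<Phi> n) \<longleftrightarrow> n \<in> {n\<in>F. s \<tturnstile>\<^bsub>P\<^esub> \<Phi> n}" if t: "t \<in> below P s" for t n
  proof -
    have "t \<in> below P p" using below_trans[OF q below_trans[OF s(1) t belowD(1)[OF q]] p] .
    then show ?thesis using bd s(2)[of n] forces_mono[OF reg belowD(1)[OF s(1)] _ t, of n] t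
      by (auto simp: forces_Neg)
  qed
  moreover have "finite {n\<in>F. s \<tturnstile>\<^bsub>P\<^esub> \<Phi> n}" using F by simp
  ultimately show "\<exists>s\<in>below P q. \<exists>F. finite F \<and> (\<forall>t\<in>below P s. \<forall>n. (t \<tturnstile>\<^bsub>P\<^esub> \<Phi> n) \<longleftrightarrow> n \<in> F)"
    using s(1) by blast
qed

text \<open>
  Monotonicity of forcing needs conditions on both sides, but a robust sentence that is forced by
  every condition is forced even by sequences not yet known to be conditions.
\<close>

definition robust :: "'c sentence \<Rightarrow> bool" where
  "robust \<phi> \<longleftrightarrow> ((\<forall>q\<in>conds P. q \<tturnstile>\<^bsub>P\<^esub> \<phi>) \<longrightarrow> (\<forall>q. q \<tturnstile>\<^bsub>P\<^esub> \<phi>))"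

lemma robustD: "\<lbrakk>robust \<phi>; \<And>q. q \<in> conds P \<Longrightarrow> q \<tturnstile>\<^bsub>P\<^esub> \<phi>\<rbrakk> \<Longrightarrow> q \<tturnstile>\<^bsub>P\<^esub> \<phi>"
  by (simp add: robust_def)

lemma robust_Neg [simp]: "robust (\<^bold>\<not> \<phi>)"
  unfolding robust_def forces_Neg by (meson below_refl belowD(1))

lemma robust_Conj [simp]: "\<lbrakk>robust \<phi>; robust \<psi>\<rbrakk> \<Longrightarrow> robust (\<phi> \<^bold>\<and> \<psi>)"
  by (simp add: robust_def)

lemma robust_AllV [simp]: "(\<And>x. robust (\<Phi> x)) \<Longrightarrow> robust (AllV \<Phi>)"
  unfolding robust_def forces_AllV by blast

lemma robust_MemF [simp]: "robust (\<sigma> \<^bold>\<in>\<^sub>F W)"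
  unfolding robust_def forces_MemF by (meson below_refl belowD(1))

lemma robust_Leq_mathias: "robust (Leq (mathias W) x y)"
  by (cases x; cases y) (simp add: mathias_def InitialSegment_def Subset_def Imp_def)

lemma robust_Elem_mathias: "robust (Elem (mathias W) x)"
  by (cases x) (simp add: mathias_def Finite_def ExV_def)

section \<open>Names given by comprehension, and forced ultrafilters\<close>

definition set_name :: "(nat \<Rightarrow> 'c sentence) \<Rightarrow> 'c real_name" where
  "set_name \<Phi> = {(s, n). s \<in> conds P \<and> (s \<tturnstile>\<^bsub>P\<^esub> \<Phi> n)}"

lemma set_name_real [simp]: "set_name \<Phi> \<in> real_names P"
  by (auto simp: set_name_def real_names_def)

text \<open>Forcing \<open>n\<close> into the name means that conditions forcing
  \<open>\<Phi> n\<close> are dense below \<open>p\<close>, which by regularity is the same as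
  forcing \<open>\<Phi> n\<close>.\<close>

lemma forces_set_name:
  assumes reg: "\<And>n. regular P (\<Phi> n)" and p: "p \<in> conds P"
  shows "(p \<tturnstile>\<^bsub>P\<^esub> n \<^bold>\<in> set_name \<Phi>) \<longleftrightarrow> (p \<tturnstile>\<^bsub>P\<^esub> \<Phi> n)"
proof -
  have "(\<exists>s. (s, n) \<in> set_name \<Phi> \<and> leq P t s) \<longleftrightarrow> (t \<tturnstile>\<^bsub>P\<^esub> \<Phi> n)" if "t \<in> conds P" for t
    using forces_mono[OF reg] that leq_refl by (auto simp: set_name_def below_def)
  then have "(p \<tturnstile>\<^bsub>P\<^esub> n \<^bold>\<in> set_name \<Phi>) \<longleftrightarrow> (\<forall>q\<in>below P p. \<exists>t\<in>below P q. t \<tturnstile>\<^bsub>P\<^esub> \<Phi> n)"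
    unfolding forces_Mem by (meson belowD(1))
  then show ?thesis using reg p unfolding regular_def by blast
qed

lemma MemF_cong:
  assumes p: "p \<in> conds P" and eq: "p \<tturnstile>\<^bsub>P\<^esub> \<sigma> \<^bold>= \<tau>" and m: "p \<tturnstile>\<^bsub>P\<^esub> \<sigma> \<^bold>\<in>\<^sub>F W"
  shows "p \<tturnstile>\<^bsub>P\<^esub> \<tau> \<^bold>\<in>\<^sub>F W"
  unfolding forces_MemF
proof
  fix q assume q: "q \<in> below P p"
  obtain t s \<rho> where t: "t \<in> below P q" and s: "(s, \<rho>) \<in> W" "leq P t s" and e: "t \<tturnstile>\<^bsub>P\<^esub> \<sigma> \<^bold>= \<rho>"
    using m q unfolding forces_MemF by blast
  have tc: "t \<in> conds P" and tp: "t \<in> below P p" using below_trans[OF q t p] belowD(1) by auto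
  have "t \<tturnstile>\<^bsub>P\<^esub> \<tau> \<^bold>= \<rho>"
    using e eq below_trans[OF tp _ p] unfolding forces_Eq[OF tc] forces_Eq[OF p] by blast
  with t s show "\<exists>t\<in>below P q. \<exists>s \<sigma>. (s, \<sigma>) \<in> W \<and> leq P t s \<and> (t \<tturnstile>\<^bsub>P\<^esub> \<tau> \<^bold>= \<sigma>)" by blast
qed

context
  fixes W
  assumes ultra: "\<tturnstile>\<^bsub>P\<^esub> Ultrafilter W"
begin

lemma Ultrafilter_infinite:
  assumes p: "p \<in> conds P" and "\<sigma> \<in> real_names P" and "p \<tturnstile>\<^bsub>P\<^esub> \<sigma> \<^bold>\<in>\<^sub>F W"
  shows "\<not> (p \<tturnstile>\<^bsub>P\<^esub> Finite (\<lambda>n. n \<^bold>\<in> \<sigma>))"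
proof -
  have "p \<tturnstile>\<^bsub>P\<^esub> \<sigma> \<^bold>\<in>\<^sub>F W \<^bold>\<longrightarrow> (\<^bold>\<not> Finite (\<lambda>n. n \<^bold>\<in> \<sigma>))"
    using ultra assms(1,2) unfolding forced_def Ultrafilter_def by simp
  then have "p \<tturnstile>\<^bsub>P\<^esub> \<^bold>\<not> Finite (\<lambda>n. n \<^bold>\<in> \<sigma>)"
    using assms(3) below_refl[OF p] by (simp add: forces_Imp[OF p])
  then show ?thesis using below_refl[OF p] by (simp add: forces_Neg)
qed

lemma Ultrafilter_Int:
  assumes p: "p \<in> conds P" and "\<sigma> \<in> real_names P" "\<tau> \<in> real_names P"
    and "p \<tturnstile>\<^bsub>P\<^esub> \<sigma> \<^bold>\<in>\<^sub>F W" "p \<tturnstile>\<^bsub>P\<^esub> \<tau> \<^bold>\<in>\<^sub>F W"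
  shows "p \<tturnstile>\<^bsub>P\<^esub> set_name (\<lambda>n. n \<^bold>\<in> \<sigma> \<^bold>\<and> n \<^bold>\<in> \<tau>) \<^bold>\<in>\<^sub>F W"
proof -
  let ?\<rho> = "set_name (\<lambda>n. n \<^bold>\<in> \<sigma> \<^bold>\<and> n \<^bold>\<in> \<tau>)"
  have "p \<tturnstile>\<^bsub>P\<^esub> \<sigma> \<^bold>\<in>\<^sub>F W \<^bold>\<and> \<tau> \<^bold>\<in>\<^sub>F W \<^bold>\<and> (\<^bold>\<forall>n. n \<^bold>\<in> ?\<rho> \<^bold>\<longleftrightarrow> n \<^bold>\<in> \<sigma> \<^bold>\<and> n \<^bold>\<in> \<tau>) \<^bold>\<longrightarrow> ?\<rho> \<^bold>\<in>\<^sub>F W"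
    using ultra p assms(2,3) set_name_real unfolding forced_def Ultrafilter_def by simp
  moreover have "p \<tturnstile>\<^bsub>P\<^esub> n \<^bold>\<in> ?\<rho> \<^bold>\<longleftrightarrow> n \<^bold>\<in> \<sigma> \<^bold>\<and> n \<^bold>\<in> \<tau>" for n
    using p by (auto simp: forces_Iff forces_set_name dest: belowD(1))
  ultimately show ?thesis using assms below_refl[OF p] by (auto simp: forces_Imp)
qed

text \<open>This is where nonprincipality enters: the complement is finite and cannot belong to
  \<open>W\<close>. The disjunction between the set and its complement is settled only densely,
  hence the passage to stronger conditions.\<close>

lemma Ultrafilter_cofinite:
  assumes p: "p \<in> conds P" and F: "finite F"
  shows "p \<tturnstile>\<^bsub>P\<^esub> set_name (\<lambda>n. Ground (n \<notin> F)) \<^bold>\<in>\<^sub>F W"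
proof (rule forces_dense[OF regular_MemF p])
  fix q assume q: "q \<in> below P p"
  then have qc: "q \<in> conds P" by (rule belowD)
  let ?\<sigma> = "set_name (\<lambda>n. Ground (n \<notin> F))" and ?\<tau> = "set_name (\<lambda>n. Ground (n \<in> F))"
  have "q \<tturnstile>\<^bsub>P\<^esub> (\<^bold>\<forall>n. n \<^bold>\<in> ?\<tau> \<^bold>\<longleftrightarrow> (\<^bold>\<not> n \<^bold>\<in> ?\<sigma>)) \<^bold>\<longrightarrow> ?\<sigma> \<^bold>\<in>\<^sub>F W \<^bold>\<or> ?\<tau> \<^bold>\<in>\<^sub>F W"
    using ultra qc set_name_real unfolding forced_def Ultrafilter_def by simp
  moreover have "s \<tturnstile>\<^bsub>P\<^esub> n \<^bold>\<in> ?\<tau> \<^bold>\<longleftrightarrow> (\<^bold>\<not> n \<^bold>\<in> ?\<sigma>)" if "s \<in> conds P" for s n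
    using that below_refl by (force simp: forces_Iff forces_set_name forces_Neg dest: belowD(1))
  ultimately have "q \<tturnstile>\<^bsub>P\<^esub> ?\<sigma> \<^bold>\<in>\<^sub>F W \<^bold>\<or> ?\<tau> \<^bold>\<in>\<^sub>F W"
    using below_refl[OF qc] qc by (auto simp: forces_Imp Disj_def)
  then obtain s where s: "s \<in> below P q" "(s \<tturnstile>\<^bsub>P\<^esub> ?\<sigma> \<^bold>\<in>\<^sub>F W) \<or> (s \<tturnstile>\<^bsub>P\<^esub> ?\<tau> \<^bold>\<in>\<^sub>F W)"
    using below_refl[OF qc] unfolding forces_Disj by blast
  have sc: "s \<in> conds P" using s by (simp add: belowD(1))
  have "s \<tturnstile>\<^bsub>P\<^esub> Finite (\<lambda>n. n \<^bold>\<in> ?\<tau>)"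
    by (rule Finite_bounded[OF F regular_Mem sc]) (simp add: forces_set_name belowD(1))
  then have "s \<tturnstile>\<^bsub>P\<^esub> ?\<sigma> \<^bold>\<in>\<^sub>F W" using Ultrafilter_infinite[OF sc] s(2) set_name_real by blast
  with s(1) show "\<exists>s\<in>below P q. s \<tturnstile>\<^bsub>P\<^esub> ?\<sigma> \<^bold>\<in>\<^sub>F W" by blast
qed

end

end

section \<open>Restriction and merging of conditions\<close>

locale mathias_iteration =
  fixes D :: "'d set" and r :: "'d rel"
    and Ul U :: "'d \<Rightarrow> ('d, 'k) cond family_name"
    and P :: "'d \<Rightarrow> ('d, 'k) cond forcing"
    and Q :: "'d \<Rightarrow> ('d, 'k) cond poset_name"
  assumes partial_order: "partial_order_on D r"
    and suitable: "suitable D r Ul U P Q"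
begin

abbreviation PP :: "'d set \<Rightarrow> ('d, 'k) cond forcing" where
  "PP \<equiv> fs_poset r P Q"

abbreviation generic :: "'d \<Rightarrow> ('d, 'k) cond real_name" where
  "generic \<equiv> generic_name r P Q"

abbreviation top_name :: "('d, 'k) cond pair_name" where
  "top_name \<equiv> ({}, {trivial} \<times> UNIV)"

text \<open>On a downward closed index set every coordinate comes with the whole sequence below it,
  at which its entry is evaluated; the clauses of \<open>PP A\<close> then never look outside
  \<open>A\<close>.\<close>

definition initial :: "'d set \<Rightarrow> bool" where
  "initial A \<longleftrightarrow> A \<subseteq> D \<and> (\<forall>x\<in>A. underS r x \<subseteq> A)"

lemma r_refl: "d \<in> D \<Longrightarrow> (d, d) \<in> r"
  and r_trans: "(x, y) \<in> r \<Longrightarrow> (y, z) \<in> r \<Longrightarrow> (x, z) \<in> r"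
  and r_antisym: "(x, y) \<in> r \<Longrightarrow> (y, x) \<in> r \<Longrightarrow> x = y"
  and r_field: "(x, y) \<in> r \<Longrightarrow> x \<in> D \<and> y \<in> D"
  using partial_order unfolding partial_order_on_def preorder_on_def
  by (auto dest: refl_onD transD antisymD)

lemma initial_D [simp]: "initial D"
  by (auto simp: initial_def underS_def dest: r_field)

lemma initial_under [simp]: "initial (under r d)"
  by (auto simp: initial_def underS_def under_def dest: r_field r_trans)

lemma initial_underS [simp]: "initial (underS r d)"
  by (auto simp: initial_def underS_def dest: r_field r_trans r_antisym)

lemma initial_subset: "initial A \<Longrightarrow> A \<subseteq> D"
  by (simp add: initial_def)

lemma initial_underS_subset: "initial A \<Longrightarrow> e \<in> A \<Longrightarrow> underS r e \<subseteq> A"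
  by (simp add: initial_def)

lemma initial_inD: "initial A \<Longrightarrow> e \<in> A \<Longrightarrow> e \<in> D"
  by (auto simp: initial_def)

lemma P_eq: "d \<in> D \<Longrightarrow> P d = PP (underS r d)"
  and enough: "d \<in> D \<Longrightarrow> enough_codes (P d)"
  and forcing_notion_P: "d \<in> D \<Longrightarrow> forcing_notion (P d) trivial"
  and Q_eq: "d \<in> D \<Longrightarrow> Q d = mathias (Ul d)"
  and Ultrafilter_Ul: "d \<in> D \<Longrightarrow> \<tturnstile>\<^bsub>P d\<^esub> Ultrafilter (Ul d)"
  and Extends_Ul: "d \<in> D \<Longrightarrow> e \<in> underS r d \<Longrightarrow> \<tturnstile>\<^bsub>P d\<^esub> Extends (Ul d) (U e)"
  and U_family: "d \<in> D \<Longrightarrow> U d \<in> family_names (PP (under r d))"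
  and Ultrafilter_U: "d \<in> D \<Longrightarrow> \<tturnstile>\<^bsub>PP (under r d)\<^esub> Ultrafilter (U d)"
  and generic_in_U: "d \<in> D \<Longrightarrow> \<tturnstile>\<^bsub>PP (under r d)\<^esub> generic d \<^bold>\<in>\<^sub>F U d"
  using suitable by (auto simp: suitable_def fs_iteration_def Let_def)

lemma forcing_preorder_P: "d \<in> D \<Longrightarrow> forcing_preorder (P d)"
  using forcing_notion_P[of d] unfolding forcing_notion_def reflp_on_def transp_on_def
  by unfold_locales blast+

lemma trivial_P: "d \<in> D \<Longrightarrow> trivial \<in> conds (P d)"
  and leq_trivial: "d \<in> D \<Longrightarrow> q \<in> conds (P d) \<Longrightarrow> leq (P d) q trivial"
  using forcing_notion_P[of d] unfolding forcing_notion_def by blast+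

lemma conds_iff: "p \<in> conds (PP A) \<longleftrightarrow> finite (dom (coord p)) \<and> dom (coord p) \<subseteq> A \<and>
    (\<forall>e\<in>A. entry p e \<in> real_names (P e) \<times> real_names (P e) \<and>
       (restr p (underS r e) \<tturnstile>\<^bsub>P e\<^esub> Elem (Q e) (entry p e)))"
  by (simp add: fs_poset_def)

lemma leq_iff: "leq (PP A) p q \<longleftrightarrow>
    (\<forall>e\<in>A. restr p (underS r e) \<tturnstile>\<^bsub>P e\<^esub> Leq (Q e) (entry p e) (entry q e))"
  by (simp add: fs_poset_def)

lemma coord_restr [simp]: "coord (restr p A) = coord p |` A"
  by (simp add: restr_def)

lemma entry_restr [simp]: "e \<in> A \<Longrightarrow> entry (restr p A) e = entry p e"
  by (simp add: entry_def)

lemma entry_None: "coord p e = None \<Longrightarrow> entry p e = top_name"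
  by (simp add: entry_def)

lemma entry_cong: "coord p e = coord q e \<Longrightarrow> entry p e = entry q e"
  by (simp add: entry_def)

lemma restr_restr: "B \<subseteq> A \<Longrightarrow> restr (restr p A) B = restr p B"
  by (simp add: restr_def Int_absorb1)

lemma restr_cong: "(\<And>e. e \<in> A \<Longrightarrow> coord p e = coord q e) \<Longrightarrow> restr p A = restr q A"
  by (auto simp: restr_def restrict_map_def)

lemma restr_id:
  assumes "dom (coord p) \<subseteq> A"
  shows "restr p A = p"
proof -
  have "(coord p |` A) e = coord p e" for e
    using assms by (cases "e \<in> A"; cases "coord p e") (auto simp: dom_def)
  then have "coord p |` A = coord p" by blast
  then show ?thesis by (simp add: restr_def)
qed

section \<open>The largest element of Mathias forcing\<close>

lemma top_name_real: "e \<in> D \<Longrightarrow> top_name \<in> real_names (P e) \<times> real_names (P e)"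
  using trivial_P by (auto simp: real_names_def)

lemma Mem_top: "e \<in> D \<Longrightarrow> q \<tturnstile>\<^bsub>P e\<^esub> n \<^bold>\<in> {trivial} \<times> UNIV"
  unfolding forces_Mem using leq_trivial[of e] forcing_preorder.below_refl[OF forcing_preorder_P, of e]
  by (fastforce dest: belowD(1))

lemma Elem_top:
  assumes "e \<in> D"
  shows "q \<tturnstile>\<^bsub>P e\<^esub> Elem (Q e) top_name"
proof -
  interpret forcing_preorder "P e" using assms by (rule forcing_preorder_P)
  show ?thesis unfolding Q_eq[OF assms]
  proof (rule robustD[OF robust_Elem_mathias])
    fix q assume q: "q \<in> conds (P e)"
    have "q \<tturnstile>\<^bsub>P e\<^esub> Finite (\<lambda>n. n \<^bold>\<in> {})"
      by (rule Finite_bounded[OF _ _ q, of "{}"])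
        (use below_refl belowD in \<open>(fastforce simp: forces_Mem)+\<close>)
    moreover have "q \<tturnstile>\<^bsub>P e\<^esub> {trivial} \<times> UNIV \<^bold>\<in>\<^sub>F Ul e"
    \<comment> \<open>The side set \<omega> is treated as the cofinite set with no
      exceptions.\<close>
    proof (rule MemF_cong[OF q])
      show "q \<tturnstile>\<^bsub>P e\<^esub> set_name (\<lambda>n. Ground (n \<notin> {})) \<^bold>\<in>\<^sub>F Ul e"
        by (rule Ultrafilter_cofinite[OF Ultrafilter_Ul[OF assms] q]) simp
      show "q \<tturnstile>\<^bsub>P e\<^esub> set_name (\<lambda>n. Ground (n \<notin> {})) \<^bold>= {trivial} \<times> UNIV"
        unfolding forces_Eq[OF q] by (simp add: forces_set_name belowD(1) Mem_top[OF assms])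
    qed
    ultimately show "q \<tturnstile>\<^bsub>P e\<^esub> Elem (mathias (Ul e)) top_name" by (simp add: mathias_def)
  qed
qed

lemma Leq_top:
  assumes "e \<in> D"
  shows "q \<tturnstile>\<^bsub>P e\<^esub> Leq (Q e) x top_name"
proof -
  interpret forcing_preorder "P e" using assms by (rule forcing_preorder_P)
  show ?thesis unfolding Q_eq[OF assms]
  proof (rule robustD[OF robust_Leq_mathias])
    fix q assume q: "q \<in> conds (P e)"
    have "\<not> (s \<tturnstile>\<^bsub>P e\<^esub> n \<^bold>\<in> {})" if "s \<in> below (P e) q" for s n
      using below_refl[OF belowD(1)[OF that]] by (auto simp: forces_Mem)
    then show "q \<tturnstile>\<^bsub>P e\<^esub> Leq (mathias (Ul e)) x top_name"
      using Mem_top[OF assms] by (intro Leq_mathiasI[OF q]) auto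
  qed
qed

section \<open>Restriction to downward closed sets\<close>

lemma restr_cond:
  assumes "B \<subseteq> A" "initial B" "p \<in> conds (PP A)"
  shows "restr p B \<in> conds (PP B)"
  using assms finite_subset[of "dom (coord p) \<inter> B" "dom (coord p)"]
  by (auto simp: conds_iff restr_restr initial_underS_subset)

lemma restr_leq: "\<lbrakk>B \<subseteq> A; initial B; leq (PP A) p q\<rbrakk> \<Longrightarrow> leq (PP B) (restr p B) (restr q B)"
  by (auto simp: leq_iff restr_restr initial_underS_subset)

lemma restr_below: "\<lbrakk>B \<subseteq> A; initial B; p \<in> below (PP A) q\<rbrakk> \<Longrightarrow> restr p B \<in> below (PP B) (restr q B)"
  by (simp add: below_def restr_cond restr_leq)

lemma restr_underS_cond:
  "\<lbrakk>initial A; e \<in> A; p \<in> conds (PP A)\<rbrakk> \<Longrightarrow> restr p (underS r e) \<in> conds (P e)"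
  using restr_cond[of "underS r e" A p] by (simp add: P_eq initial_inD[of A] initial_underS_subset)

lemma restr_underS_below:
  "\<lbrakk>initial A; e \<in> A; p \<in> below (PP A) q\<rbrakk> \<Longrightarrow> restr p (underS r e) \<in> below (P e) (restr q (underS r e))"
  using restr_below[of "underS r e" A p q] by (simp add: P_eq initial_inD[of A] initial_underS_subset)

text \<open>For transitivity, the comparison of \<open>q\<close> with \<open>s\<close> at
  \<open>e\<close> is forced by the part of \<open>q\<close> below \<open>e\<close>. Since
  restriction preserves the order, it persists to the part of \<open>p\<close>, where Mathias
  transitivity applies.\<close>

lemma forcing_preorder_PP:
  assumes A: "initial A"
  shows "forcing_preorder (PP A)"
proof
  fix p assume p: "p \<in> conds (PP A)"
  show "leq (PP A) p p" unfolding leq_iff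
  proof
    fix e assume e: "e \<in> A"
    then show "restr p (underS r e) \<tturnstile>\<^bsub>P e\<^esub> Leq (Q e) (entry p e) (entry p e)"
      using forcing_preorder.Leq_mathias_refl[OF forcing_preorder_P restr_underS_cond[OF A e p]]
        initial_inD[OF A e] by (simp add: Q_eq)
  qed
next
  fix p q s assume c: "p \<in> conds (PP A)" "q \<in> conds (PP A)" "s \<in> conds (PP A)"
    and l: "leq (PP A) p q" "leq (PP A) q s"
  show "leq (PP A) p s" unfolding leq_iff
  proof
    fix e assume e: "e \<in> A"
    then have eD: "e \<in> D" by (rule initial_inD[OF A])
    then interpret forcing_preorder "P e" by (rule forcing_preorder_P)
    have pq: "restr p (underS r e) \<in> below (P e) (restr q (underS r e))"
      using c(1) l(1) by (intro restr_underS_below[OF A e]) (simp add: below_def)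
    have "restr q (underS r e) \<tturnstile>\<^bsub>P e\<^esub> Leq (Q e) (entry q e) (entry s e)"
      using l(2) e by (simp add: leq_iff)
    then have qs: "restr p (underS r e) \<tturnstile>\<^bsub>P e\<^esub> Leq (Q e) (entry q e) (entry s e)"
      using forces_mono[OF _ restr_underS_cond[OF A e c(2)] _ pq] by (simp add: Q_eq[OF eD])
    have "restr p (underS r e) \<tturnstile>\<^bsub>P e\<^esub> Leq (Q e) (entry p e) (entry q e)"
      using l(1) e by (simp add: leq_iff)
    from Leq_mathias_trans[OF belowD(1)[OF pq] this[unfolded Q_eq[OF eD]] qs[unfolded Q_eq[OF eD]]]
    show "restr p (underS r e) \<tturnstile>\<^bsub>P e\<^esub> Leq (Q e) (entry p e) (entry s e)"
      by (simp add: Q_eq[OF eD])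
  qed
qed

text \<open>
  Since \<open>r\<close> need not be well-founded, that \<open>q\<close> is a condition cannot be checked by recursion along
  \<open>r\<close>.  The supports are finite, though, and trivial coordinates cause no problem because of
  robustness, so one may induct on the number of support elements below \<open>e\<close>.
\<close>

lemma extend_cond:
  assumes A: "initial A" and p: "p \<in> conds (PP A)"
    and q: "finite (dom (coord q))" "dom (coord q) \<subseteq> A"
    and step: "\<And>e. e \<in> A \<Longrightarrow> coord q e = coord p e \<or>
      entry q e \<in> real_names (P e) \<times> real_names (P e) \<and>
      (restr q (underS r e) \<in> below (P e) (restr p (underS r e)) \<longrightarrow>
        (restr q (underS r e) \<tturnstile>\<^bsub>P e\<^esub> Elem (Q e) (entry q e)) \<and>
        (restr q (underS r e) \<tturnstile>\<^bsub>P e\<^esub> Leq (Q e) (entry q e) (entry p e)))"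
  shows "q \<in> below (PP A) p"
proof -
  define S where "S = dom (coord p) \<union> dom (coord q)"
  have S: "finite S" "S \<subseteq> A" using p q by (auto simp: S_def conds_iff)
  \<comment> \<open>At an altered support point \<open>step\<close> speaks only under this premise,
    and at an unaltered one it is what allows monotonicity; so everything reduces to proving
    \<open>R\<close>.\<close>
  define R where "R e \<longleftrightarrow> restr q (underS r e) \<in> below (P e) (restr p (underS r e))" for e
  have good: "entry q e \<in> real_names (P e) \<times> real_names (P e) \<and>
      (restr q (underS r e) \<tturnstile>\<^bsub>P e\<^esub> Elem (Q e) (entry q e)) \<and>
      (restr q (underS r e) \<tturnstile>\<^bsub>P e\<^esub> Leq (Q e) (entry q e) (entry p e))"
    if e: "e \<in> A" and Re: "e \<in> S \<longrightarrow> R e" for e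
  proof (cases "e \<in> S")
    case False
    then have "coord q e = None" "coord p e = None" by (auto simp: S_def)
    then show ?thesis
      using Elem_top Leq_top top_name_real initial_inD[OF A e] by (simp add: entry_None)
  next
    case True
    show ?thesis
    proof (cases "coord q e = coord p e")
      case False
      then show ?thesis using step[OF e] Re \<open>e \<in> S\<close> unfolding R_def by blast
    next
      case eq: True
      have eD: "e \<in> D" using initial_inD[OF A e] .
      interpret forcing_preorder "P e" using eD by (rule forcing_preorder_P)
      have Re: "restr q (underS r e) \<in> below (P e) (restr p (underS r e))"
        using Re True by (simp add: R_def)
      have "restr p (underS r e) \<tturnstile>\<^bsub>P e\<^esub> Elem (Q e) (entry p e)"
        and names: "entry p e \<in> real_names (P e) \<times> real_names (P e)"
        using p e by (auto simp: conds_iff)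
      then have "restr q (underS r e) \<tturnstile>\<^bsub>P e\<^esub> Elem (Q e) (entry p e)"
        using forces_mono[OF _ restr_underS_cond[OF A e p] _ Re] by (simp add: Q_eq[OF eD])
      then show ?thesis
        using names entry_cong[OF eq] Leq_mathias_refl[OF belowD(1)[OF Re]] by (simp add: Q_eq[OF eD])
    qed
  qed
  have piece: "restr q B \<in> below (PP B) (restr p B)"
    if B: "B \<subseteq> A" "initial B" and RB: "\<And>e. e \<in> B \<Longrightarrow> e \<in> S \<Longrightarrow> R e" for B
  proof -
    have g: "entry q e \<in> real_names (P e) \<times> real_names (P e) \<and>
      (restr q (underS r e) \<tturnstile>\<^bsub>P e\<^esub> Elem (Q e) (entry q e)) \<and>
      (restr q (underS r e) \<tturnstile>\<^bsub>P e\<^esub> Leq (Q e) (entry q e) (entry p e))" if "e \<in> B" for e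
      using good[of e] that B(1) RB by blast
    have "restr q B \<in> conds (PP B)"
      using g q(1) finite_subset[of "dom (coord q) \<inter> B" "dom (coord q)"] B(2)
      by (simp add: conds_iff restr_restr initial_underS_subset)
    moreover have "leq (PP B) (restr q B) (restr p B)"
      using g B(2) by (simp add: leq_iff restr_restr initial_underS_subset)
    ultimately show ?thesis by (simp add: below_def)
  qed
  have "R e" if "e \<in> A" for e
    using that
  proof (induction "card (S \<inter> underS r e)" arbitrary: e rule: less_induct)
    case less
    have "restr q (underS r e) \<in> below (PP (underS r e)) (restr p (underS r e))"
    proof (rule piece)
      show "underS r e \<subseteq> A" using initial_underS_subset[OF A less.prems] .
      fix c assume c: "c \<in> underS r e" "c \<in> S"
      \<comment> \<open>The point \<open>c\<close> itself lies in the right-hand set but not in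
        \<open>underS r c\<close>, so the inclusion is strict.\<close>
      then have "S \<inter> underS r c \<subset> S \<inter> underS r e"
        by (auto simp: underS_def dest: r_trans r_antisym)
      then have "card (S \<inter> underS r c) < card (S \<inter> underS r e)"
        using S(1) by (simp add: psubset_card_mono)
      then show "R c" using less.hyps c S(2) by blast
    qed simp
    then show ?case unfolding R_def P_eq[OF initial_inD[OF A less.prems]] .
  qed
  then have "restr q A \<in> below (PP A) (restr p A)" using piece A by blast
  moreover have "restr q A = q" "restr p A = p" using q p by (auto simp: restr_id conds_iff)
  ultimately show ?thesis by simp
qed

section \<open>Pasting a strengthening on a smaller index set into a condition\<close>

definition merge :: "('d, 'k) cond \<Rightarrow> ('d, 'k) cond \<Rightarrow> 'd set \<Rightarrow> ('d, 'k) cond" where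
  "merge q p A = Seq (\<lambda>e. if e \<in> A then coord q e else coord p e)"

lemma restr_merge: "B \<subseteq> A \<Longrightarrow> restr (merge q p A) B = restr q B"
  by (rule restr_cong) (auto simp: merge_def)

lemma entry_merge_in: "e \<in> A \<Longrightarrow> entry (merge q p A) e = entry q e"
  by (rule entry_cong) (simp add: merge_def)

lemma entry_merge_out: "e \<notin> A \<Longrightarrow> entry (merge q p A) e = entry p e"
  by (rule entry_cong) (simp add: merge_def)

lemma cond_restr_id: "p \<in> conds (PP A) \<Longrightarrow> restr p A = p"
  by (simp add: conds_iff restr_id)

text \<open>Inside \<open>A\<close> the entries are evaluated at restrictions of \<open>q\<close>
  alone, because \<open>A\<close> is downward closed. Outside \<open>A\<close> the entries of
  \<open>p\<close> are kept and are merely evaluated below a stronger condition, which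
  \<open>extend_cond\<close> allows.\<close>

lemma merge_below:
  assumes AB: "A \<subseteq> B" and A: "initial A" and B: "initial B"
    and p: "p \<in> conds (PP B)" and q: "q \<in> below (PP A) (restr p A)"
  shows "merge q p A \<in> below (PP B) p"
proof (rule extend_cond[OF B p])
  have "dom (coord (merge q p A)) \<subseteq> dom (coord p) \<union> dom (coord q)"
    by (auto simp: merge_def split: if_splits)
  moreover have "finite (dom (coord p))" "finite (dom (coord q))"
    and sub: "dom (coord p) \<subseteq> B" "dom (coord q) \<subseteq> A"
    using p belowD(1)[OF q] by (auto simp: conds_iff)
  ultimately show "finite (dom (coord (merge q p A)))" "dom (coord (merge q p A)) \<subseteq> B"
    using AB finite_subset by blast+
  fix e assume e: "e \<in> B"
  show "coord (merge q p A) e = coord p e \<or>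
      entry (merge q p A) e \<in> real_names (P e) \<times> real_names (P e) \<and>
      (restr (merge q p A) (underS r e) \<in> below (P e) (restr p (underS r e)) \<longrightarrow>
        (restr (merge q p A) (underS r e) \<tturnstile>\<^bsub>P e\<^esub> Elem (Q e) (entry (merge q p A) e)) \<and>
        (restr (merge q p A) (underS r e) \<tturnstile>\<^bsub>P e\<^esub> Leq (Q e) (entry (merge q p A) e) (entry p e)))"
  proof (cases "e \<in> A")
    case False
    then show ?thesis by (simp add: merge_def)
  next
    case True
    moreover from this have "restr (merge q p A) (underS r e) = restr q (underS r e)"
      using A by (simp add: restr_merge initial_underS_subset)
    ultimately show ?thesis using belowD[OF q] by (auto simp: conds_iff leq_iff entry_merge_in)
  qed
qed

section \<open>Comparing \<open>PP A\<close> and \<open>PP B\<close> for downward closed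
  \<open>A \<subseteq> B\<close>\<close>

lemma conds_mono:
  assumes "A \<subseteq> B" "initial A" "initial B"
  shows "conds (PP A) \<subseteq> conds (PP B)"
proof
  fix p assume p: "p \<in> conds (PP A)"
  have "entry p e \<in> real_names (P e) \<times> real_names (P e) \<and>
      (restr p (underS r e) \<tturnstile>\<^bsub>P e\<^esub> Elem (Q e) (entry p e))" if e: "e \<in> B" for e
  proof (cases "e \<in> A")
    case True
    then show ?thesis using p by (simp add: conds_iff)
  next
    case False
    then have "coord p e = None" using p by (auto simp: conds_iff domIff)
    then show ?thesis using Elem_top top_name_real initial_inD[OF assms(3) e] by (simp add: entry_None)
  qed
  then show "p \<in> conds (PP B)" using p assms(1) by (auto simp: conds_iff)
qed

lemma real_names_mono: "\<lbrakk>A \<subseteq> B; initial A; initial B\<rbrakk> \<Longrightarrow> real_names (PP A) \<subseteq> real_names (PP B)"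
  using conds_mono unfolding real_names_def by blast

text \<open>Outside \<open>A\<close> the entry of \<open>s\<close> is the top name, and every entry
  is forced to be below that; only the coordinates in \<open>A\<close> impose anything.\<close>

lemma leq_iff_restr:
  assumes "A \<subseteq> B" "initial A" "initial B" "s \<in> conds (PP A)"
  shows "leq (PP B) p s \<longleftrightarrow> leq (PP A) (restr p A) s"
proof
  assume "leq (PP B) p s"
  from restr_leq[OF assms(1,2) this] show "leq (PP A) (restr p A) s"
    using assms(4) by (simp add: cond_restr_id)
next
  assume l: "leq (PP A) (restr p A) s"
  show "leq (PP B) p s" unfolding leq_iff
  proof
    fix e assume e: "e \<in> B"
    show "restr p (underS r e) \<tturnstile>\<^bsub>P e\<^esub> Leq (Q e) (entry p e) (entry s e)"
    proof (cases "e \<in> A")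
      case True
      then show ?thesis using l assms(2) by (auto simp: leq_iff restr_restr initial_underS_subset)
    next
      case False
      then have "coord s e = None" using assms(4) by (auto simp: conds_iff domIff)
      then show ?thesis using Leq_top initial_inD[OF assms(3) e] by (simp add: entry_None)
    qed
  qed
qed

text \<open>\<open>PP A\<close> is completely embedded in \<open>PP B\<close>, with \<open>restr _ A\<close> as projection.\<close>

lemma dense_restr:
  assumes AB: "A \<subseteq> B" "initial A" "initial B" and p: "p \<in> conds (PP B)"
  shows "(\<forall>q\<in>below (PP B) p. \<exists>t\<in>below (PP B) q. \<phi> (restr t A)) \<longleftrightarrow>
    (\<forall>q\<in>below (PP A) (restr p A). \<exists>t\<in>below (PP A) q. \<phi> t)"
proof
  assume L: "\<forall>q\<in>below (PP B) p. \<exists>t\<in>below (PP B) q. \<phi> (restr t A)"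
  show "\<forall>q\<in>below (PP A) (restr p A). \<exists>t\<in>below (PP A) q. \<phi> t"
  proof
    fix q assume q: "q \<in> below (PP A) (restr p A)"
    obtain t where t: "t \<in> below (PP B) (merge q p A)" "\<phi> (restr t A)"
      using L merge_below[OF AB p q] by blast
    have "restr t A \<in> below (PP A) q"
      using restr_below[OF AB(1,2) t(1)] belowD(1)[OF q] by (simp add: restr_merge cond_restr_id)
    with t(2) show "\<exists>t\<in>below (PP A) q. \<phi> t" by blast
  qed
next
  assume R: "\<forall>q\<in>below (PP A) (restr p A). \<exists>t\<in>below (PP A) q. \<phi> t"
  show "\<forall>q\<in>below (PP B) p. \<exists>t\<in>below (PP B) q. \<phi> (restr t A)"
  proof
    fix q assume q: "q \<in> below (PP B) p"
    obtain t where t: "t \<in> below (PP A) (restr q A)" "\<phi> t"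
      using R restr_below[OF AB(1,2) q] by blast
    have "restr (merge t q A) A = t"
      using belowD(1)[OF t(1)] by (simp add: restr_merge cond_restr_id)
    with t(2) merge_below[OF AB belowD(1)[OF q] t(1)]
    show "\<exists>t\<in>below (PP B) q. \<phi> (restr t A)" by metis
  qed
qed

text \<open>The conditions in the name have support in \<open>A\<close>, so being below one of them
  depends only on the restriction to \<open>A\<close>; density questions then transfer by
  \<open>dense_restr\<close>.\<close>

lemma Mem_restr:
  assumes AB: "A \<subseteq> B" "initial A" "initial B" and \<sigma>: "\<sigma> \<in> real_names (PP A)"
    and p: "p \<in> conds (PP B)"
  shows "(p \<tturnstile>\<^bsub>PP B\<^esub> n \<^bold>\<in> \<sigma>) \<longleftrightarrow> (restr p A \<tturnstile>\<^bsub>PP A\<^esub> n \<^bold>\<in> \<sigma>)"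
proof -
  have "(\<exists>s. (s, n) \<in> \<sigma> \<and> leq (PP B) t s) \<longleftrightarrow> (\<exists>s. (s, n) \<in> \<sigma> \<and> leq (PP A) (restr t A) s)" for t
    using leq_iff_restr[OF AB] \<sigma> unfolding real_names_def by blast
  then show ?thesis unfolding forces_Mem
    by (simp add: dense_restr[OF AB p, of "\<lambda>t. \<exists>s. (s, n) \<in> \<sigma> \<and> leq (PP A) t s"])
qed

text \<open>Witnesses for membership lift through the projection, and the equality of names they
  come with lifts because \<open>Mem_restr\<close> applies at every stronger condition.\<close>

lemma MemF_restr:
  assumes AB: "A \<subseteq> B" "initial A" "initial B" and \<tau>: "\<tau> \<in> real_names (PP A)"
    and W: "W \<in> family_names (PP A)" and p: "p \<in> conds (PP B)"
    and f: "restr p A \<tturnstile>\<^bsub>PP A\<^esub> \<tau> \<^bold>\<in>\<^sub>F W"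
  shows "p \<tturnstile>\<^bsub>PP B\<^esub> \<tau> \<^bold>\<in>\<^sub>F W"
  unfolding forces_MemF
proof
  interpret A: forcing_preorder "PP A" using AB by (intro forcing_preorder_PP)
  interpret B: forcing_preorder "PP B" using AB by (intro forcing_preorder_PP)
  fix q assume q: "q \<in> below (PP B) p"
  have "\<exists>t\<in>below (PP B) q. \<exists>s \<sigma>. (s, \<sigma>) \<in> W \<and> leq (PP A) (restr t A) s \<and> (restr t A \<tturnstile>\<^bsub>PP A\<^esub> \<tau> \<^bold>= \<sigma>)"
    using f q dense_restr[OF AB p, of "\<lambda>t. \<exists>s \<sigma>. (s, \<sigma>) \<in> W \<and> leq (PP A) t s \<and> (t \<tturnstile>\<^bsub>PP A\<^esub> \<tau> \<^bold>= \<sigma>)"]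
    unfolding forces_MemF by blast
  then obtain t s \<sigma> where t: "t \<in> below (PP B) q" and s: "(s, \<sigma>) \<in> W" "leq (PP A) (restr t A) s"
    and eq: "restr t A \<tturnstile>\<^bsub>PP A\<^esub> \<tau> \<^bold>= \<sigma>" by blast
  have sA: "s \<in> conds (PP A)" and \<sigma>: "\<sigma> \<in> real_names (PP A)" using W s(1) by (auto simp: family_names_def)
  have tB: "t \<in> conds (PP B)" using t by (rule belowD)
  have "t \<tturnstile>\<^bsub>PP B\<^esub> \<tau> \<^bold>= \<sigma>" unfolding B.forces_Eq[OF tB]
    using eq[unfolded A.forces_Eq[OF restr_cond[OF AB(1,2) tB]]] restr_below[OF AB(1,2)]
      Mem_restr[OF AB \<tau>] Mem_restr[OF AB \<sigma>] belowD(1) by metis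
  with t s leq_iff_restr[OF AB sA]
  show "\<exists>t\<in>below (PP B) q. \<exists>s \<sigma>. (s, \<sigma>) \<in> W \<and> leq (PP B) t s \<and> (t \<tturnstile>\<^bsub>PP B\<^esub> \<tau> \<^bold>= \<sigma>)" by blast
qed

section \<open>Generic sets\<close>

text \<open>The side set at \<open>e\<close> is intersected with \<open>C\<close>, which stays in
  the ultrafilter. As only coordinate \<open>e\<close> changes, restrictions to sets missing
  \<open>e\<close> are literally unchanged, so what they force is kept.\<close>

lemma shrink_side_set:
  assumes B: "initial B" and e: "e \<in> B" and p: "p \<in> conds (PP B)"
    and C: "C \<in> real_names (P e)" and CU: "restr p (underS r e) \<tturnstile>\<^bsub>P e\<^esub> C \<^bold>\<in>\<^sub>F Ul e"
  obtains q where "q \<in> below (PP B) p" "\<And>A. e \<notin> A \<Longrightarrow> restr q A = restr p A"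
    "fst (entry q e) = fst (entry p e)"
    "\<And>s n. \<lbrakk>s \<in> below (P e) (restr p (underS r e)); s \<tturnstile>\<^bsub>P e\<^esub> n \<^bold>\<in> snd (entry q e)\<rbrakk> \<Longrightarrow> s \<tturnstile>\<^bsub>P e\<^esub> n \<^bold>\<in> C"
proof -
  have eD: "e \<in> D" using initial_inD[OF B e] .
  interpret forcing_preorder "P e" using eD by (rule forcing_preorder_P)
  let ?p = "restr p (underS r e)"
  have pe: "?p \<in> conds (P e)" using restr_underS_cond[OF B e p] .
  obtain a A where aA: "entry p e = (a, A)" by fastforce
  have a: "a \<in> real_names (P e)" and A: "A \<in> real_names (P e)"
    and fin: "?p \<tturnstile>\<^bsub>P e\<^esub> Finite (\<lambda>n. n \<^bold>\<in> a)" and AU: "?p \<tturnstile>\<^bsub>P e\<^esub> A \<^bold>\<in>\<^sub>F Ul e"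
    using p e aA by (auto simp: conds_iff Q_eq[OF eD] mathias_def)
  define I where "I = set_name (\<lambda>n. n \<^bold>\<in> A \<^bold>\<and> n \<^bold>\<in> C)"
  have I: "(s \<tturnstile>\<^bsub>P e\<^esub> n \<^bold>\<in> I) \<longleftrightarrow> (s \<tturnstile>\<^bsub>P e\<^esub> n \<^bold>\<in> A) \<and> (s \<tturnstile>\<^bsub>P e\<^esub> n \<^bold>\<in> C)" if "s \<in> conds (P e)" for s n
    unfolding I_def by (simp add: forces_set_name that)
  have IU: "?p \<tturnstile>\<^bsub>P e\<^esub> I \<^bold>\<in>\<^sub>F Ul e"
    unfolding I_def by (rule Ultrafilter_Int[OF Ultrafilter_Ul[OF eD] pe A C AU CU])
  have "I \<in> real_names (P e)" by (simp add: I_def)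
  \<comment> \<open>A condition can only store coded names, so the intersection is replaced by a
    coded name forced to be equal to it.\<close>
  with enough[OF eD] obtain c :: "'k \<Rightarrow> (('d, 'k) cond \<times> nat) option"
    where c: "ran c \<in> real_names (P e)" "\<tturnstile>\<^bsub>P e\<^esub> I \<^bold>= ran c"
    unfolding enough_codes_def by blast
  have cI: "(s \<tturnstile>\<^bsub>P e\<^esub> n \<^bold>\<in> ran c) \<longleftrightarrow> (s \<tturnstile>\<^bsub>P e\<^esub> n \<^bold>\<in> I)" if "s \<in> conds (P e)" for s n
    using c(2) forces_Eq[OF that] below_refl[OF that] that by (auto simp: forced_def)
  have cU: "?p \<tturnstile>\<^bsub>P e\<^esub> ran c \<^bold>\<in>\<^sub>F Ul e"
    using MemF_cong[OF pe _ IU] c(2) pe by (simp add: forced_def)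
  \<comment> \<open>The unchanged stem needs a code as well; at a trivial coordinate it is empty and
    is coded by the empty map.\<close>
  obtain a' :: "'k \<Rightarrow> (('d, 'k) cond \<times> nat) option" where a': "ran a' = a"
  proof (cases "coord p e")
    case None
    then show ?thesis using that[of Map.empty] aA by (simp add: entry_def)
  next
    case (Some x)
    then show ?thesis using that[of "fst x"] aA by (cases x) (simp add: entry_def)
  qed
  define q where "q = Seq ((coord p)(e \<mapsto> (a', c)))"
  have qe: "entry q e = (a, ran c)" by (simp add: q_def entry_def a')
  have rq: "restr q X = restr p X" if "e \<notin> X" for X
    by (rule restr_cong) (use that in \<open>auto simp: q_def\<close>)
  have rqe: "restr q (underS r e) = ?p" by (rule rq) (simp add: underS_def)
  have "q \<in> below (PP B) p"
  proof (rule extend_cond[OF B p])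
    show "finite (dom (coord q))" "dom (coord q) \<subseteq> B"
      using p e by (auto simp: q_def conds_iff)
    fix x assume "x \<in> B"
    have "?p \<tturnstile>\<^bsub>P e\<^esub> Elem (Q e) (a, ran c)"
      using fin cU by (simp add: Q_eq[OF eD] mathias_def)
    moreover have "?p \<tturnstile>\<^bsub>P e\<^esub> Leq (Q e) (a, ran c) (a, A)"
      unfolding Q_eq[OF eD]
      by (rule Leq_mathiasI[OF pe]; use below_refl in \<open>force simp: cI I forces_Neg dest: belowD(1)\<close>)
    ultimately show "coord q x = coord p x \<or>
      entry q x \<in> real_names (P x) \<times> real_names (P x) \<and>
      (restr q (underS r x) \<in> below (P x) (restr p (underS r x)) \<longrightarrow>
        (restr q (underS r x) \<tturnstile>\<^bsub>P x\<^esub> Elem (Q x) (entry q x)) \<and>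
        (restr q (underS r x) \<tturnstile>\<^bsub>P x\<^esub> Leq (Q x) (entry q x) (entry p x)))"
      by (cases "x = e") (simp_all add: qe rqe aA a c(1), simp add: q_def)
  qed
  then show ?thesis
    using that[of q] rq qe aA cI I belowD(1) by fastforce
qed

section \<open>What a condition determines about a generic set\<close>

lemma generic_real: "generic d \<in> real_names (PP (under r d))"
  by (auto simp: generic_name_def real_names_def)

lemma under_D: "d \<in> D \<Longrightarrow> under r d \<subseteq> D"
  by (simp add: initial_subset)

lemma underS_D: "underS r d \<subseteq> D"
  by (simp add: initial_subset)

text \<open>A point enters the generic set through the stem of some condition, and the stem of
  anything below \<open>p\<close> grows only by points of the side set of \<open>p\<close>. Thus the
  single entry of \<open>p\<close> at \<open>d\<close> limits what later conditions can put into the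
  set.\<close>

lemma Mem_generic_cases:
  assumes d: "d \<in> D" and p: "p \<in> conds (PP D)" and q: "q \<in> below (PP D) p"
    and n: "q \<tturnstile>\<^bsub>PP D\<^esub> n \<^bold>\<in> generic d"
  obtains t where "t \<in> below (PP D) q"
    "(restr t (underS r d) \<tturnstile>\<^bsub>P d\<^esub> n \<^bold>\<in> fst (entry p d)) \<or> (restr t (underS r d) \<tturnstile>\<^bsub>P d\<^esub> n \<^bold>\<in> snd (entry p d))"
proof -
  interpret Pd: forcing_preorder "P d" using d by (rule forcing_preorder_P)
  interpret PD: forcing_preorder "PP D" by (simp add: forcing_preorder_PP)
  interpret Pud: forcing_preorder "PP (under r d)" by (simp add: forcing_preorder_PP)
  have ud: "d \<in> under r d" using d by (simp add: under_def r_refl)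
  have sub: "underS r d \<subseteq> under r d" by (auto simp: underS_def under_def)
  have qc: "q \<in> conds (PP D)" using q by (rule belowD)
  let ?q = "restr q (under r d)"
  have qc': "?q \<in> conds (PP (under r d))" using restr_cond[OF under_D[OF d] _ qc] by simp
  have "?q \<tturnstile>\<^bsub>PP (under r d)\<^esub> n \<^bold>\<in> generic d"
    using n Mem_restr[OF under_D[OF d] _ _ generic_real qc] by simp
  then obtain x s where x: "x \<in> below (PP (under r d)) ?q" and s: "(s, n) \<in> generic d" "leq (PP (under r d)) x s"
    unfolding forces_Mem using Pud.below_refl[OF qc'] by blast
  have sc: "s \<in> conds (PP (under r d))" and sn: "restr s (underS r d) \<tturnstile>\<^bsub>P d\<^esub> n \<^bold>\<in> fst (entry s d)"
    using s(1) by (auto simp: generic_name_def)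
  have xs: "x \<in> below (PP (under r d)) s" using x s(2) by (simp add: below_def)
  have xs': "restr x (underS r d) \<in> below (P d) (restr s (underS r d))"
    by (rule restr_underS_below[OF _ ud xs]) simp
  have "restr x (underS r d) \<tturnstile>\<^bsub>P d\<^esub> n \<^bold>\<in> fst (entry s d)"
    using Pd.forces_mono[OF Pd.regular_Mem _ sn xs'] restr_underS_cond[OF _ ud sc] by simp
  moreover have "restr x (underS r d) \<tturnstile>\<^bsub>P d\<^esub> Leq (mathias (Ul d)) (entry x d) (entry s d)"
    using s(2) ud by (simp add: leq_iff flip: Q_eq[OF d])
  ultimately have xn: "restr x (underS r d) \<tturnstile>\<^bsub>P d\<^esub> n \<^bold>\<in> fst (entry x d)"
    using Pd.Leq_mathiasD(1)[OF belowD(1)[OF xs'] _ Pd.below_refl[OF belowD(1)[OF xs']]] by blast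
  \<comment> \<open>The witness \<open>x\<close> lives on \<open>under r d\<close> only; pasted into
    \<open>q\<close> it lies below \<open>p\<close>, so its entry at \<open>d\<close> can be
    compared with that of \<open>p\<close>.\<close>
  define y where "y = merge x q (under r d)"
  have yq: "y \<in> below (PP D) q"
    unfolding y_def using merge_below[OF under_D[OF d] _ _ qc x] by simp
  have y: "restr y (underS r d) = restr x (underS r d)" "entry y d = entry x d"
    by (simp_all add: y_def restr_merge[OF sub] entry_merge_in[OF ud])
  have yp: "y \<in> below (PP D) p" using PD.below_trans[OF q yq p] .
  have yc: "restr y (underS r d) \<in> conds (P d)"
    using restr_underS_cond[OF initial_D d belowD(1)[OF yq]] .
  have "restr y (underS r d) \<tturnstile>\<^bsub>P d\<^esub> Leq (mathias (Ul d)) (entry y d) (entry p d)"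
    using belowD(2)[OF yp] d by (simp add: leq_iff flip: Q_eq[OF d])
  then obtain z where z: "z \<in> below (P d) (restr y (underS r d))"
    "(z \<tturnstile>\<^bsub>P d\<^esub> n \<^bold>\<in> fst (entry p d)) \<or> (z \<tturnstile>\<^bsub>P d\<^esub> n \<^bold>\<in> snd (entry p d))"
    by (rule Pd.Leq_mathias_step[OF yc, of "Ul d" "entry y d" "entry p d" n]) (use xn y that in simp_all)
  have z': "z \<in> below (PP (underS r d)) (restr y (underS r d))" using z(1) by (simp add: P_eq[OF d])
  have "merge z y (underS r d) \<in> below (PP D) y"
    by (rule merge_below[OF underS_D _ _ belowD(1)[OF yq] z']) simp_all
  moreover have "restr (merge z y (underS r d)) (underS r d) = z"
    using belowD(1)[OF z'] by (simp add: restr_merge cond_restr_id)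
  ultimately show ?thesis using that[of "merge z y (underS r d)"] z(2) PD.below_trans[OF yq _ qc] by simp
qed

text \<open>The stem at \<open>d\<close> is a \<open>P d\<close>-name, so strengthening the
  coordinates strictly below \<open>d\<close> suffices to decide it, and the entry at
  \<open>d\<close> itself is kept.\<close>

lemma decide_stem:
  assumes d: "d \<in> D" and p: "p \<in> conds (PP D)"
  obtains q F where "q \<in> below (PP D) p" "finite F" "fst (entry q d) = fst (entry p d)"
    "\<And>s n. s \<in> below (P d) (restr q (underS r d)) \<Longrightarrow> (s \<tturnstile>\<^bsub>P d\<^esub> n \<^bold>\<in> fst (entry p d)) \<longleftrightarrow> n \<in> F"
proof -
  interpret Pd: forcing_preorder "P d" using d by (rule forcing_preorder_P)
  have pc: "restr p (underS r d) \<in> conds (P d)" using restr_underS_cond[OF initial_D d p] .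
  have "restr p (underS r d) \<tturnstile>\<^bsub>P d\<^esub> Finite (\<lambda>n. n \<^bold>\<in> fst (entry p d))"
    using p d by (cases "entry p d") (auto simp: conds_iff Q_eq mathias_def)
  then obtain x F where x: "x \<in> below (P d) (restr p (underS r d))" and F: "finite F"
    "\<And>s n. s \<in> below (P d) x \<Longrightarrow> (s \<tturnstile>\<^bsub>P d\<^esub> n \<^bold>\<in> fst (entry p d)) \<longleftrightarrow> n \<in> F"
    by (rule Pd.Finite_decide[rotated 2, of "restr p (underS r d)" "\<lambda>n. n \<^bold>\<in> fst (entry p d)"])
      (simp_all add: pc)
  have x': "x \<in> below (PP (underS r d)) (restr p (underS r d))" using x by (simp add: P_eq[OF d])
  have "merge x p (underS r d) \<in> below (PP D) p"
    by (rule merge_below[OF underS_D _ _ p x']) simp_all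
  moreover have "restr (merge x p (underS r d)) (underS r d) = x"
    using belowD(1)[OF x'] by (simp add: restr_merge cond_restr_id)
  moreover have "entry (merge x p (underS r d)) d = entry p d"
    by (rule entry_merge_out) (simp add: underS_def)
  ultimately show ?thesis using that[of "merge x p (underS r d)" F] F by simp
qed

text \<open>Suitability puts the generic set into \<open>U e\<close> over \<open>under r e\<close>.
  As \<open>under r e\<close> is contained in \<open>underS r d\<close>, this lifts to
  \<open>P d\<close>, where \<open>Ul d\<close> extends \<open>U e\<close>.\<close>

lemma generic_in_Ul:
  assumes d: "d \<in> D" and e: "e \<in> underS r d" and p: "p \<in> conds (P d)"
  shows "generic e \<in> real_names (P d)" "p \<tturnstile>\<^bsub>P d\<^esub> generic e \<^bold>\<in>\<^sub>F Ul d"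
proof -
  interpret Pd: forcing_preorder "P d" using d by (rule forcing_preorder_P)
  have eD: "e \<in> D" using e underS_D by blast
  have sub: "under r e \<subseteq> underS r d"
    using e by (auto simp: under_def underS_def dest: r_trans r_antisym)
  show g: "generic e \<in> real_names (P d)"
    unfolding P_eq[OF d] using real_names_mono[OF sub] generic_real by auto
  have p': "p \<in> conds (PP (underS r d))" using p by (simp add: P_eq[OF d])
  have "restr p (under r e) \<in> conds (PP (under r e))" using restr_cond[OF sub _ p'] by simp
  then have "restr p (under r e) \<tturnstile>\<^bsub>PP (under r e)\<^esub> generic e \<^bold>\<in>\<^sub>F U e"
    using generic_in_U[OF eD] by (simp add: forced_def)
  then have "p \<tturnstile>\<^bsub>P d\<^esub> generic e \<^bold>\<in>\<^sub>F U e"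
    unfolding P_eq[OF d] by (intro MemF_restr[OF sub _ _ generic_real U_family[OF eD] p']) simp_all
  moreover have "p \<tturnstile>\<^bsub>P d\<^esub> generic e \<^bold>\<in>\<^sub>F U e \<^bold>\<longrightarrow> generic e \<^bold>\<in>\<^sub>F Ul d"
    using Extends_Ul[OF d e] p g by (simp add: forced_def Extends_def)
  ultimately show "p \<tturnstile>\<^bsub>P d\<^esub> generic e \<^bold>\<in>\<^sub>F Ul d"
    using Pd.below_refl[OF p] by (simp add: Pd.forces_Imp[OF p])
qed

section \<open>Almost inclusion between generic sets\<close>

lemma generic_AlmostSubset_less:
  assumes d: "d \<in> D" and e: "e \<in> underS r d" and p: "p \<in> conds (PP D)"
  shows "p \<tturnstile>\<^bsub>PP D\<^esub> generic d \<^bold>\<subseteq>\<^sup>* generic e"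
proof -
  interpret Pd: forcing_preorder "P d" using d by (rule forcing_preorder_P)
  interpret PD: forcing_preorder "PP D" by (simp add: forcing_preorder_PP)
  show ?thesis
  proof (rule PD.forces_dense[OF PD.regular_AlmostSubset p])
    fix q assume q: "q \<in> below (PP D) p"
    let ?a = "fst (entry q d)"
    obtain x F where x: "x \<in> below (PP D) q" and F: "finite F" and xa: "fst (entry x d) = ?a"
      and xF: "\<And>s n. s \<in> below (P d) (restr x (underS r d)) \<Longrightarrow> (s \<tturnstile>\<^bsub>P d\<^esub> n \<^bold>\<in> ?a) \<longleftrightarrow> n \<in> F"
      by (rule decide_stem[OF d belowD(1)[OF q]]) (rule that)
    have xc: "x \<in> conds (PP D)" using x by (rule belowD)
    have xdc: "restr x (underS r d) \<in> conds (P d)" using restr_underS_cond[OF initial_D d xc] .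
    obtain y where y: "y \<in> below (PP D) x" "\<And>A. d \<notin> A \<Longrightarrow> restr y A = restr x A"
      "fst (entry y d) = fst (entry x d)"
      "\<And>s n. \<lbrakk>s \<in> below (P d) (restr x (underS r d)); s \<tturnstile>\<^bsub>P d\<^esub> n \<^bold>\<in> snd (entry y d)\<rbrakk> \<Longrightarrow> s \<tturnstile>\<^bsub>P d\<^esub> n \<^bold>\<in> generic e"
      by (rule shrink_side_set[OF initial_D d xc generic_in_Ul[OF d e xdc]]) (rule that)
    have yc: "y \<in> conds (PP D)" using y(1) by (rule belowD)
    have yx: "restr y (underS r d) = restr x (underS r d)" by (rule y(2)) (simp add: underS_def)
    have "y \<tturnstile>\<^bsub>PP D\<^esub> generic d \<^bold>\<subseteq>\<^sup>* generic e" unfolding AlmostSubset_def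
    \<comment> \<open>The decided stem \<open>F\<close> bounds the difference: a point outside it
      could enter the set at \<open>d\<close> only through the shrunken side set, and then some
      extension would force it into \<open>generic e\<close>.\<close>
    proof (rule PD.Finite_bounded[OF F _ yc])
      fix t n assume t: "t \<in> below (PP D) y" and "t \<tturnstile>\<^bsub>PP D\<^esub> n \<^bold>\<in> generic d \<^bold>\<and> (\<^bold>\<not> n \<^bold>\<in> generic e)"
      then have n: "t \<tturnstile>\<^bsub>PP D\<^esub> n \<^bold>\<in> generic d" and ne: "t \<tturnstile>\<^bsub>PP D\<^esub> \<^bold>\<not> n \<^bold>\<in> generic e" by simp_all
      obtain u where u: "u \<in> below (PP D) t" and or: "(restr u (underS r d) \<tturnstile>\<^bsub>P d\<^esub> n \<^bold>\<in> fst (entry y d)) \<or>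
          (restr u (underS r d) \<tturnstile>\<^bsub>P d\<^esub> n \<^bold>\<in> snd (entry y d))"
        by (rule Mem_generic_cases[OF d yc t n]) (rule that)
      have ux: "restr u (underS r d) \<in> below (P d) (restr x (underS r d))"
        using restr_underS_below[OF initial_D d PD.below_trans[OF t u yc]] by (simp add: yx)
      from or show "n \<in> F"
      proof
        assume "restr u (underS r d) \<tturnstile>\<^bsub>P d\<^esub> n \<^bold>\<in> fst (entry y d)"
        then show ?thesis using xF[OF ux] xa y(3) by simp
      next
        assume "restr u (underS r d) \<tturnstile>\<^bsub>P d\<^esub> n \<^bold>\<in> snd (entry y d)"
        then have "restr u (underS r d) \<tturnstile>\<^bsub>PP (underS r d)\<^esub> n \<^bold>\<in> generic e"
          using y(4)[OF ux] by (simp add: P_eq[OF d])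
        then have "u \<tturnstile>\<^bsub>PP D\<^esub> n \<^bold>\<in> generic e"
          using Mem_restr[OF underS_D _ _ _ belowD(1)[OF u]] generic_in_Ul(1)[OF d e xdc]
          by (simp add: P_eq[OF d])
        then show ?thesis using ne u by (simp add: forces_Neg)
      qed
    qed simp
    with PD.below_trans[OF x y(1) belowD(1)[OF q]]
    show "\<exists>s\<in>below (PP D) q. s \<tturnstile>\<^bsub>PP D\<^esub> generic d \<^bold>\<subseteq>\<^sup>* generic e" by blast
  qed
qed

lemma AlmostSubset_refl:
  assumes p: "p \<in> conds (PP D)"
  shows "p \<tturnstile>\<^bsub>PP D\<^esub> \<sigma> \<^bold>\<subseteq>\<^sup>* \<sigma>"
proof -
  interpret PD: forcing_preorder "PP D" by (simp add: forcing_preorder_PP)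
  show ?thesis unfolding AlmostSubset_def
  proof (rule PD.Finite_bounded[OF finite.emptyI _ p])
    fix q n assume q: "q \<in> below (PP D) p" and "q \<tturnstile>\<^bsub>PP D\<^esub> n \<^bold>\<in> \<sigma> \<^bold>\<and> (\<^bold>\<not> n \<^bold>\<in> \<sigma>)"
    then show "n \<in> {}" using PD.below_refl[OF belowD(1)[OF q]] by (auto simp: forces_Neg)
  qed simp
qed

text \<open>
  The part of a condition in \<open>under r d\<close> can force arbitrarily large \<open>n\<close> into the set added at
  \<open>d\<close>.  It does not mention the coordinate \<open>e\<close>, where \<open>n\<close> may then be removed from the side set.
\<close>

lemma not_generic_AlmostSubset:
  assumes d: "d \<in> D" and e: "e \<in> D" and ed: "(e, d) \<notin> r" and p: "p \<in> conds (PP D)"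
  shows "\<not> (p \<tturnstile>\<^bsub>PP D\<^esub> generic d \<^bold>\<subseteq>\<^sup>* generic e)"
proof
  assume sub: "p \<tturnstile>\<^bsub>PP D\<^esub> generic d \<^bold>\<subseteq>\<^sup>* generic e"
  interpret Pe: forcing_preorder "P e" using e by (rule forcing_preorder_P)
  interpret PD: forcing_preorder "PP D" by (simp add: forcing_preorder_PP)
  interpret Pud: forcing_preorder "PP (under r d)" by (simp add: forcing_preorder_PP)
  have eu: "e \<notin> under r d" using ed by (simp add: under_def)
  let ?\<Phi> = "\<lambda>n. n \<^bold>\<in> generic d \<^bold>\<and> (\<^bold>\<not> n \<^bold>\<in> generic e)"
  obtain q F where q: "q \<in> below (PP D) p" and F: "finite F"
    and qF: "\<And>s n. s \<in> below (PP D) q \<Longrightarrow> (s \<tturnstile>\<^bsub>PP D\<^esub> ?\<Phi> n) \<longleftrightarrow> n \<in> F"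
    by (rule PD.Finite_decide[OF _ p sub[unfolded AlmostSubset_def]]) (simp, rule that)
  have qc: "q \<in> conds (PP D)" using q by (rule belowD)
  \<comment> \<open>The decision of the stem at \<open>e\<close> may strengthen coordinates that
    also lie below \<open>d\<close>, so it is made before those are used to produce
    \<open>n\<close>.\<close>
  obtain x F' where x: "x \<in> below (PP D) q" and F': "finite F'" and xa: "fst (entry x e) = fst (entry q e)"
    and xF: "\<And>s n. s \<in> below (P e) (restr x (underS r e)) \<Longrightarrow> (s \<tturnstile>\<^bsub>P e\<^esub> n \<^bold>\<in> fst (entry q e)) \<longleftrightarrow> n \<in> F'"
    by (rule decide_stem[OF e qc]) (rule that)
  have xc: "x \<in> conds (PP D)" using x by (rule belowD)
  let ?x = "restr x (under r d)"
  have xdc: "?x \<in> conds (PP (under r d))" using restr_cond[OF under_D[OF d] _ xc] by simp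
  \<comment> \<open>Infinity is used over \<open>under r d\<close>, where \<open>U d\<close> is an
    ultrafilter; the witness \<open>y\<close> found there therefore has no coordinate at
    \<open>e\<close>.\<close>
  have "\<not> (?x \<tturnstile>\<^bsub>PP (under r d)\<^esub> Finite (\<lambda>n. n \<^bold>\<in> generic d))"
    using Pud.Ultrafilter_infinite[OF Ultrafilter_U[OF d] xdc generic_real] generic_in_U[OF d] xdc
    by (simp add: forced_def)
  \<comment> \<open>Avoiding \<open>F\<close> contradicts the decided difference; avoiding
    \<open>F'\<close> keeps \<open>n\<close> out of the stem at \<open>e\<close>. If all possible
    points lay in \<open>F \<union> F'\<close>, the set would be forced to be finite.\<close>
  then obtain y n where y: "y \<in> below (PP (under r d)) ?x" and n: "y \<tturnstile>\<^bsub>PP (under r d)\<^esub> n \<^bold>\<in> generic d"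
    and nF: "n \<notin> F \<union> F'"
    using Pud.Finite_bounded[OF _ _ xdc, of "F \<union> F'" "\<lambda>n. n \<^bold>\<in> generic d"] F F' by auto
  define z where "z = merge y x (under r d)"
  have z: "z \<in> below (PP D) x"
    unfolding z_def using merge_below[OF under_D[OF d] _ _ xc y] by simp
  have zc: "z \<in> conds (PP D)" using z by (rule belowD)
  have zy: "restr z (under r d) = y"
    using belowD(1)[OF y] by (simp add: z_def restr_merge cond_restr_id)
  have ze: "entry z e = entry x e" unfolding z_def by (rule entry_merge_out[OF eu])
  have zec: "restr z (underS r e) \<in> conds (P e)" using restr_underS_cond[OF initial_D e zc] .
  \<comment> \<open>Only the point \<open>n\<close> has to be barred from \<open>e\<close>, and a
    cofinite set belongs to any nonprincipal ultrafilter.\<close>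
  let ?C = "Pe.set_name (\<lambda>m. Ground (m \<notin> {n}))"
  have CU: "restr z (underS r e) \<tturnstile>\<^bsub>P e\<^esub> ?C \<^bold>\<in>\<^sub>F Ul e"
    by (rule Pe.Ultrafilter_cofinite[OF Ultrafilter_Ul[OF e] zec]) simp
  obtain w where w: "w \<in> below (PP D) z" "\<And>A. e \<notin> A \<Longrightarrow> restr w A = restr z A"
    "fst (entry w e) = fst (entry z e)"
    "\<And>s m. \<lbrakk>s \<in> below (P e) (restr z (underS r e)); s \<tturnstile>\<^bsub>P e\<^esub> m \<^bold>\<in> snd (entry w e)\<rbrakk> \<Longrightarrow> s \<tturnstile>\<^bsub>P e\<^esub> m \<^bold>\<in> ?C"
    by (rule shrink_side_set[OF initial_D e zc Pe.set_name_real CU]) (rule that)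
  have wc: "w \<in> conds (PP D)" using w(1) by (rule belowD)
  have "restr w (under r d) = y" using w(2)[OF eu] zy by simp
  then have wd: "w \<tturnstile>\<^bsub>PP D\<^esub> n \<^bold>\<in> generic d"
    using n Mem_restr[OF under_D[OF d] _ _ generic_real wc] by simp
  have "w \<tturnstile>\<^bsub>PP D\<^esub> \<^bold>\<not> n \<^bold>\<in> generic e" unfolding forces_Neg
  proof (intro ballI notI)
    fix t assume t: "t \<in> below (PP D) w" and tn: "t \<tturnstile>\<^bsub>PP D\<^esub> n \<^bold>\<in> generic e"
    obtain u where u: "u \<in> below (PP D) t" and or: "(restr u (underS r e) \<tturnstile>\<^bsub>P e\<^esub> n \<^bold>\<in> fst (entry w e)) \<or>
        (restr u (underS r e) \<tturnstile>\<^bsub>P e\<^esub> n \<^bold>\<in> snd (entry w e))"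
      by (rule Mem_generic_cases[OF e wc t tn]) (rule that)
    have uz: "u \<in> below (PP D) z" using PD.below_trans[OF w(1) PD.below_trans[OF t u wc] zc] .
    have uz': "restr u (underS r e) \<in> below (P e) (restr z (underS r e))"
      using restr_underS_below[OF initial_D e uz] .
    \<comment> \<open>The stem was decided below \<open>x\<close> and the side set was controlled
      below \<open>z\<close>, so the two cases need \<open>u\<close> placed below different
      restrictions.\<close>
    have ux': "restr u (underS r e) \<in> below (P e) (restr x (underS r e))"
      using restr_underS_below[OF initial_D e PD.below_trans[OF z uz xc]] .
    from or show False
    proof
      assume "restr u (underS r e) \<tturnstile>\<^bsub>P e\<^esub> n \<^bold>\<in> fst (entry w e)"
      then show False using xF[OF ux', of n] nF w(3) ze xa by simp
    next
      assume "restr u (underS r e) \<tturnstile>\<^bsub>P e\<^esub> n \<^bold>\<in> snd (entry w e)"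
      then show False using w(4)[OF uz', of n] by (simp add: Pe.forces_set_name belowD(1)[OF uz'])
    qed
  qed
  then have "w \<tturnstile>\<^bsub>PP D\<^esub> ?\<Phi> n" using wd by simp
  moreover have "w \<in> below (PP D) q"
    using PD.below_trans[OF x PD.below_trans[OF z w(1) xc] qc] .
  ultimately show False using qF nF by blast
qed

lemma forces_generic_AlmostSubset:
  assumes "d \<in> D" "e \<in> D" "p \<in> conds (PP D)"
  shows "(p \<tturnstile>\<^bsub>PP D\<^esub> generic d \<^bold>\<subseteq>\<^sup>* generic e) \<longleftrightarrow> (e, d) \<in> r"
proof (cases "e = d")
  case True
  then show ?thesis using assms AlmostSubset_refl r_refl by simp
next
  case False
  then show ?thesis
    using assms generic_AlmostSubset_less[of d e p] not_generic_AlmostSubset[of d e p]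
    by (auto simp: underS_def)
qed

section \<open>The order isomorphism\<close>

lemma leq_PP_trivial: "leq (PP D) q trivial"
  unfolding leq_iff by (simp add: entry_None[of trivial] trivial_def[THEN arg_cong, of coord] Leq_top)

lemma forces_OrderIso:
  assumes p: "p \<in> conds (PP D)"
  shows "p \<tturnstile>\<^bsub>PP D\<^esub> OrderIso D r generic"
proof -
  interpret PD: forcing_preorder "PP D" by (simp add: forcing_preorder_PP)
  define R where "R = {(trivial :: ('d, 'k) cond, generic d) | d. d \<in> D}"
  have 1: "q \<tturnstile>\<^bsub>PP D\<^esub> generic d \<^bold>\<in>\<^sub>F R" if "d \<in> D" for q d
    unfolding forces_MemF
  proof
    fix s assume "s \<in> below (PP D) q"
    then have s: "s \<in> conds (PP D)" by (rule belowD)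
    have "(trivial, generic d) \<in> R" using that by (auto simp: R_def)
    moreover have "s \<tturnstile>\<^bsub>PP D\<^esub> generic d \<^bold>= generic d" by (simp add: PD.forces_Eq[OF s])
    ultimately show "\<exists>t\<in>below (PP D) s. \<exists>c \<sigma>. (c, \<sigma>) \<in> R \<and> leq (PP D) t c \<and> (t \<tturnstile>\<^bsub>PP D\<^esub> generic d \<^bold>= \<sigma>)"
      using PD.below_refl[OF s] leq_PP_trivial by blast
  qed
  \<comment> \<open>The index \<open>d\<close> may vary with the condition, which is exactly what
    the forced existential quantifier permits.\<close>
  have 2: "q \<tturnstile>\<^bsub>PP D\<^esub> (\<^bold>\<exists>d. Ground (d \<in> D) \<^bold>\<and> \<sigma> \<^bold>= generic d)" if "q \<tturnstile>\<^bsub>PP D\<^esub> \<sigma> \<^bold>\<in>\<^sub>F R" for q \<sigma>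
    using that unfolding forces_MemF PD.forces_ExV by (fastforce simp: R_def)
  \<comment> \<open>Forced equality makes both differences empty, hence gives almost inclusion in
    both directions; injectivity is then antisymmetry of \<open>r\<close>.\<close>
  have 3: "d = e" if "d \<in> D" "e \<in> D" "q \<in> conds (PP D)" "q \<tturnstile>\<^bsub>PP D\<^esub> generic d \<^bold>= generic e" for q d e
  proof -
    have eq: "(s \<tturnstile>\<^bsub>PP D\<^esub> n \<^bold>\<in> generic d) \<longleftrightarrow> (s \<tturnstile>\<^bsub>PP D\<^esub> n \<^bold>\<in> generic e)" if "s \<in> below (PP D) q" for s n
      using \<open>q \<tturnstile>\<^bsub>PP D\<^esub> generic d \<^bold>= generic e\<close> that unfolding PD.forces_Eq[OF \<open>q \<in> conds (PP D)\<close>] by blast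
    have "q \<tturnstile>\<^bsub>PP D\<^esub> generic d \<^bold>\<subseteq>\<^sup>* generic e" "q \<tturnstile>\<^bsub>PP D\<^esub> generic e \<^bold>\<subseteq>\<^sup>* generic d"
      unfolding AlmostSubset_def
      by (rule PD.Finite_bounded[OF finite.emptyI _ \<open>q \<in> conds (PP D)\<close>];
          use eq PD.below_refl belowD(1) in \<open>force simp: forces_Neg\<close>)+
    then show ?thesis using that forces_generic_AlmostSubset r_antisym by blast
  qed
  show ?thesis
    unfolding OrderIso_def Let_def R_def[symmetric]
    using p 1 2 3[OF _ _ belowD(1)] forces_generic_AlmostSubset
    by (auto simp: PD.forces_Imp PD.forces_Iff belowD(1))
qed

end

theorem theorem3p7:
  fixes D :: "'d set" and r :: "'d rel"
    and Ul U :: "'d \<Rightarrow> ('d, 'k) cond family_name"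
    and P :: "'d \<Rightarrow> ('d, 'k) cond forcing"
    and Q :: "'d \<Rightarrow> ('d, 'k) cond poset_name"
  assumes "partial_order_on D r"
    and "suitable D r Ul U P Q"
  shows "(\<forall>d\<in>D. \<forall>e\<in>D. \<tturnstile>\<^bsub>fs_poset r P Q D\<^esub>
            (generic_name r P Q d \<^bold>\<subseteq>\<^sup>* generic_name r P Q e \<^bold>\<longleftrightarrow> Ground ((e, d) \<in> r))) \<and>
         (\<tturnstile>\<^bsub>fs_poset r P Q D\<^esub> OrderIso D r (generic_name r P Q))"
proof -
  interpret mathias_iteration D r Ul U P Q using assms by unfold_locales
  interpret PD: forcing_preorder "PP D" by (simp add: forcing_preorder_PP)
  show ?thesis
    using forces_generic_AlmostSubset forces_OrderIso
    by (simp add: forced_def PD.forces_Iff belowD(1))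
qed

end
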